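(* Let $(p,\alpha)$ be an almost adjoint invariant cocentral action of a discrete group $\Gamma$ on a Hopf algebra $A$ over a field $K$, where $\alpha$ is defined by a pair $(\phi,\mu)$, $\phi\colon\Gamma\to H^1(A)$, $\mu\colon\Gamma\times\Gamma\to H^1_\ell(A)$. Define the linear map $\sigma\colon A\otimes A\to K$ by $\sigma(a\otimes b)=\phi^{-1}_{p(a)}(b)$. Then (i) $\sigma$ is a pseudo-$2$-cocycle on $A$, with convolution inverse given by $\sigma^{-1}\colon A\otimes A\to K$, $a\otimes b\mapsto\phi_{p(a)}(b)$; (ii) the map $j\colon A\to A\rtimes_\alpha\Gamma$, $j(a)=a_{(1)}\otimes p(a_{(2)})$, defines a Hopf algebra isomorphism of the twist $A^\sigma$ of $A$ by $\sigma$ onto $A^{t,\alpha}\subset A\rtimes_\alpha\Gamma$.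
   Context: Sweedler notation is used. $K$ is a field, $\Gamma$ a discrete group with identity $e$, $K\Gamma$ its group algebra (a Hopf algebra with group-like $g\in\Gamma$). A Hopf algebra homomorphism $p\colon A\to K\Gamma$ is cocentral if $p(a_{(1)})\otimes a_{(2)}=p(a_{(2)})\otimes a_{(1)}$ for all $a$. An invariant cocentral action $(p,\alpha)$ of $\Gamma$ on $A$ consists of a cocentral Hopf algebra homomorphism $p\colon A\to K\Gamma$ and an action $\alpha$ of $\Gamma$ on $A$ by Hopf algebra automorphisms with $p\alpha_g=p$ for all $g$. Put $A_g=\{a\in A\mid a_{(1)}\otimes p(a_{(2)})=a\otimes g\}$; then $A=\bigoplus_{g}A_g$. The crossed product $A\rtimes_\alpha\Gamma$ is $A\otimes K\Gamma$ with product $(a\otimes g)(b\otimes h)=a\alpha_g(b)\otimes gh$, coproduct $\Delta(a\otimes g)=(a_{(1)}\otimes g)\otimes(a_{(2)}\otimes g)$, counit $\varepsilon(a\otimes g)=\varepsilon(a)$, antipode $S(a\otimes g)=S(\alpha_{g^{-1}}(a))\otimes g^{-1}$. The graded twisting $A^{t,\alpha}$ is the Hopf subalgebra of $A\rtimes_\alpha\Gamma$ spanned by the elements $a\otimes g$ with $g\in\Gamma$, $a\in A_g$. $H^1(A)$ is the group of algebra homomorphisms $A\to K$ under convolution $(\mu*\nu)(a)=\mu(a_{(1)})\nu(a_{(2)})$, and $H^1_\ell(A)$ is its subgroup of those $\omega$ with $\omega(a_{(1)})a_{(2)}=a_{(1)}\omega(a_{(2)})$ for all $a$. The action $\alpha$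 is almost adjoint, defined by the pair $(\phi,\mu)$, if $\phi\colon\Gamma\to H^1(A)$, $g\mapsto\phi_g$, is a map and $\mu$ is a $2$-cocycle on $\Gamma$ with values in the trivial $\Gamma$-module $H^1_\ell(A)$ such that $\phi_e=\varepsilon$, $\phi_g*\phi_h=\phi_{gh}*\mu(g,h)=\mu(g,h)*\phi_{gh}$ (equivalently, $\phi$ lifts a group homomorphism $\Gamma\to H^1(A)/H^1_\ell(A)$), and $\alpha_g(a)=\phi_g^{-1}(a_{(1)})\,a_{(2)}\,\phi_g(a_{(3)})$, where $\phi_g^{-1}$ is the convolution inverse. The maps $g\mapsto\phi_g$ and $g\mapsto\phi_g^{-1}$ are extended linearly to $K\Gamma$: $\phi_x=\sum_g x_g\phi_g$ and $\phi_x^{-1}=\sum_g x_g\phi_g^{-1}$ for $x=\sum_g x_g g$. A convolution invertible $\sigma\in(A\otimes A)^*$ is a pseudo-$2$-cocycle if the product $a\cdot b=\sigma(a_{(1)},b_{(1)})\,a_{(2)}b_{(2)}\,\sigma^{-1}(a_{(3)},b_{(3)})$ on $A$ is associative with the original $1$ as unit, and $A$ with this product and the original coproduct is a Hopf algebra; this Hopf algebra is denoted $A^\sigma$. *)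

theory Defs
  imports "HOL.Vector_Spaces" "HOL-Library.Poly_Mapping" "HOL-Algebra.Group"
begin

section \<open>Formal linear combinations and tensor products\<close>

text \<open>
  The ground field is a type \<open>'k::field\<close>; a vector space is a type \<open>'a::ab_group_add\<close> together with
  a scaling \<open>s\<close> satisfying \<^const>\<open>vector_space\<close>.  The type \<open>'x \<Rightarrow>\<^sub>0 'k\<close> is the vector
  space with basis \<open>'x\<close>.
\<close>

definition pm_scale :: "('k \<Rightarrow> 'v \<Rightarrow> 'v) \<Rightarrow> 'k \<Rightarrow> ('x \<Rightarrow>\<^sub>0 'v::zero) \<Rightarrow> ('x \<Rightarrow>\<^sub>0 'v)" where
  "pm_scale s c u = Poly_Mapping.map (s c) u"

abbreviation fscale :: "'k \<Rightarrow> ('x \<Rightarrow>\<^sub>0 'k::field) \<Rightarrow> ('x \<Rightarrow>\<^sub>0 'k)" where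
  "fscale \<equiv> pm_scale (*)"

abbreviation basis :: "'x \<Rightarrow> ('x \<Rightarrow>\<^sub>0 'k::field)" where
  "basis x \<equiv> Poly_Mapping.single x 1"

definition lincomb ::
  "('k \<Rightarrow> 'v \<Rightarrow> 'v) \<Rightarrow> ('x \<Rightarrow>\<^sub>0 'k::field) \<Rightarrow> ('x \<Rightarrow> 'v) \<Rightarrow> 'v::ab_group_add" where
  "lincomb s u F = (\<Sum>x\<in>Poly_Mapping.keys u. s (Poly_Mapping.lookup u x) (F x))"

text \<open>
  \<open>V \<otimes> W\<close> is the free vector space on \<open>V \<times> W\<close> modulo the bilinearity relations; its elements are
  cosets of formal linear combinations of pairs.
\<close>

definition tensor_null ::
  "('k::field \<Rightarrow> 'a::ab_group_add \<Rightarrow> 'a) \<Rightarrow> ('k \<Rightarrow> 'b::ab_group_add \<Rightarrow> 'b) \<Rightarrow> ('a \<times> 'b \<Rightarrow>\<^sub>0 'k) set" where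
  "tensor_null s t = module.span fscale
     ({basis (x + x', y) - basis (x, y) - basis (x', y) | x x' y. True}
      \<union> {basis (x, y + y') - basis (x, y) - basis (x, y') | x y y'. True}
      \<union> {basis (s c x, y) - fscale c (basis (x, y)) | c x y. True}
      \<union> {basis (x, t c y) - fscale c (basis (x, y)) | c x y. True})"

definition tensor_class ::
  "('k::field \<Rightarrow> 'a::ab_group_add \<Rightarrow> 'a) \<Rightarrow> ('k \<Rightarrow> 'b::ab_group_add \<Rightarrow> 'b) \<Rightarrow>
   ('a \<times> 'b \<Rightarrow>\<^sub>0 'k) \<Rightarrow> ('a \<times> 'b \<Rightarrow>\<^sub>0 'k) set" where
  "tensor_class s t u = {v. v - u \<in> tensor_null s t}"

definition tensor_space ::
  "('k::field \<Rightarrow> 'a::ab_group_add \<Rightarrow> 'a) \<Rightarrow> ('k \<Rightarrow> 'b::ab_group_add \<Rightarrow> 'b) \<Rightarrow>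
   ('a \<times> 'b \<Rightarrow>\<^sub>0 'k) set set" where
  "tensor_space s t = range (tensor_class s t)"

definition tensor_rep :: "('x \<Rightarrow>\<^sub>0 'k::field) set \<Rightarrow> ('x \<Rightarrow>\<^sub>0 'k)" where
  "tensor_rep T = (SOME u. u \<in> T)"

text \<open>The threefold tensor product \<open>V \<otimes> V \<otimes> V\<close>, needed for coassociativity.\<close>

definition tensor3_null ::
  "('k::field \<Rightarrow> 'a::ab_group_add \<Rightarrow> 'a) \<Rightarrow> ('a \<times> 'a \<times> 'a \<Rightarrow>\<^sub>0 'k) set" where
  "tensor3_null s = module.span fscale
     ({basis (x + x', y, z) - basis (x, y, z) - basis (x', y, z) | x x' y z. True}
      \<union> {basis (x, y + y', z) - basis (x, y, z) - basis (x, y', z) | x y y' z. True}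
      \<union> {basis (x, y, z + z') - basis (x, y, z) - basis (x, y, z') | x y z z'. True}
      \<union> {basis (s c x, y, z) - fscale c (basis (x, y, z)) | c x y z. True}
      \<union> {basis (x, s c y, z) - fscale c (basis (x, y, z)) | c x y z. True}
      \<union> {basis (x, y, s c z) - fscale c (basis (x, y, z)) | c x y z. True})"

definition tensor3_class ::
  "('k::field \<Rightarrow> 'a::ab_group_add \<Rightarrow> 'a) \<Rightarrow> ('a \<times> 'a \<times> 'a \<Rightarrow>\<^sub>0 'k) \<Rightarrow> ('a \<times> 'a \<times> 'a \<Rightarrow>\<^sub>0 'k) set" where
  "tensor3_class s u = {v. v - u \<in> tensor3_null s}"

definition bilinear_map ::
  "('k::field \<Rightarrow> 'a::ab_group_add \<Rightarrow> 'a) \<Rightarrow> ('k \<Rightarrow> 'b::ab_group_add \<Rightarrow> 'b) \<Rightarrow>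
   ('k \<Rightarrow> 'c::ab_group_add \<Rightarrow> 'c) \<Rightarrow> ('a \<Rightarrow> 'b \<Rightarrow> 'c) \<Rightarrow> bool" where
  "bilinear_map s t r F \<longleftrightarrow>
     (\<forall>x. Vector_Spaces.linear t r (F x)) \<and> (\<forall>y. Vector_Spaces.linear s r (\<lambda>x. F x y))"

lemma lookup_pm_scale:
  assumes "s c 0 = 0"
  shows "Poly_Mapping.lookup (pm_scale s c u) x = s c (Poly_Mapping.lookup u x)"
  using assms unfolding pm_scale_def by (simp add: Poly_Mapping.map.rep_eq when_def)

lemma vector_space_pm_scale:
  assumes "vector_space s"
  shows "vector_space (pm_scale s :: 'k::field \<Rightarrow> ('x \<Rightarrow>\<^sub>0 'a::ab_group_add) \<Rightarrow> _)"
proof -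
  interpret vector_space s by fact
  show ?thesis
    by unfold_locales
      (rule poly_mapping_eqI, simp add: lookup_pm_scale lookup_add algebra_simps)+
qed

lemma vector_space_mult: "vector_space ((*) :: 'k::field \<Rightarrow> 'k \<Rightarrow> 'k)"
  by unfold_locales (simp_all add: algebra_simps)

lemma vector_space_fscale: "vector_space (fscale :: 'k::field \<Rightarrow> ('x \<Rightarrow>\<^sub>0 'k) \<Rightarrow> _)"
  by (rule vector_space_pm_scale[OF vector_space_mult])

lemma lincomb_superset:
  assumes "vector_space s" "finite X" "Poly_Mapping.keys u \<subseteq> X"
  shows "lincomb s u F = (\<Sum>x\<in>X. s (Poly_Mapping.lookup u x) (F x))"
proof -
  interpret vector_space s by fact
  show ?thesis unfolding lincomb_def
    using assms by (intro sum.mono_neutral_left) (auto simp: in_keys_iff)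
qed

lemma linear_lincomb:
  fixes s :: "'k::field \<Rightarrow> 'v::ab_group_add \<Rightarrow> 'v" and F :: "'x \<Rightarrow> 'v"
  assumes "vector_space s"
  shows "Vector_Spaces.linear fscale s (\<lambda>u. lincomb s u F)"
proof -
  interpret S: vector_space s by fact
  interpret T: vector_space "fscale :: 'k \<Rightarrow> ('x \<Rightarrow>\<^sub>0 'k) \<Rightarrow> _" by (rule vector_space_fscale)
  show ?thesis
  proof unfold_locales
    fix u v :: "'x \<Rightarrow>\<^sub>0 'k"
    let ?X = "Poly_Mapping.keys u \<union> Poly_Mapping.keys v"
    show "lincomb s (u + v) F = lincomb s u F + lincomb s v F"
      using keys_add[of u v]
      by (simp add: lincomb_superset[OF assms, of ?X] lookup_add S.scale_left_distrib sum.distrib)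
  next
    fix c and u :: "'x \<Rightarrow>\<^sub>0 'k"
    have "Poly_Mapping.keys (fscale c u) \<subseteq> Poly_Mapping.keys u"
      by (auto simp: in_keys_iff lookup_pm_scale)
    then show "lincomb s (fscale c u) F = s c (lincomb s u F)"
      by (simp add: lincomb_superset[OF assms, of "Poly_Mapping.keys u"] lookup_pm_scale
            S.scale_sum_right)
  qed
qed

lemma lincomb_basis: "vector_space s \<Longrightarrow> lincomb s (basis x) F = F x"
  by (simp add: lincomb_def vector_space_def)

lemma lincomb_basis_self: "lincomb fscale u basis = u"
proof (rule poly_mapping_eqI)
  fix x
  have "Poly_Mapping.lookup (lincomb fscale u basis) x =
      (\<Sum>y\<in>Poly_Mapping.keys u. if y = x then Poly_Mapping.lookup u y else 0)"
    unfolding lincomb_def lookup_sum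
    by (rule sum.cong) (auto simp: lookup_pm_scale lookup_single when_def)
  also have "\<dots> = Poly_Mapping.lookup u x"
    by (simp add: sum.delta in_keys_iff)
  finally show "Poly_Mapping.lookup (lincomb fscale u basis) x = Poly_Mapping.lookup u x" .
qed

text \<open>Bilinear maps factor through the tensor product.\<close>

lemma lincomb_tensor_null:
  fixes s :: "'k::field \<Rightarrow> 'a::ab_group_add \<Rightarrow> 'a" and t :: "'k \<Rightarrow> 'b::ab_group_add \<Rightarrow> 'b"
  assumes r: "vector_space r" and F: "bilinear_map s t r F" and u: "u \<in> tensor_null s t"
  shows "lincomb r u (\<lambda>(x, y). F x y) = 0"
proof -
  interpret T: vector_space "fscale :: 'k \<Rightarrow> ('a \<times> 'b \<Rightarrow>\<^sub>0 'k) \<Rightarrow> _" by (rule vector_space_fscale)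
  let ?L = "\<lambda>u. lincomb r u (\<lambda>(x, y). F x y)"
  interpret L: Vector_Spaces.linear fscale r ?L by (rule linear_lincomb[OF r])
  have F1: "Vector_Spaces.linear t r (F x)" and F2: "Vector_Spaces.linear s r (\<lambda>x. F x y)" for x y
    using F by (auto simp: bilinear_map_def)
  note [simp] = lincomb_basis[OF r] L.diff L.scale
    module_hom.add[OF Vector_Spaces.linear.axioms(3)[OF F1]]
    module_hom.scale[OF Vector_Spaces.linear.axioms(3)[OF F1]]
    module_hom.add[OF Vector_Spaces.linear.axioms(3)[OF F2]]
    module_hom.scale[OF Vector_Spaces.linear.axioms(3)[OF F2]]
  show ?thesis
    using u unfolding tensor_null_def
  proof (rule T.span_induct)
    show "T.subspace {u. ?L u = 0}" by (auto simp: T.subspace_def L.add L.zero)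
  qed auto
qed

lemma tensor_null_subspace:
  fixes s :: "'k::field \<Rightarrow> 'a::ab_group_add \<Rightarrow> 'a" and t :: "'k \<Rightarrow> 'b::ab_group_add \<Rightarrow> 'b"
  shows "module.subspace fscale (tensor_null s t)"
proof -
  interpret T: vector_space "fscale :: 'k \<Rightarrow> ('a \<times> 'b \<Rightarrow>\<^sub>0 'k) \<Rightarrow> _" by (rule vector_space_fscale)
  show ?thesis unfolding tensor_null_def by (rule T.subspace_span)
qed

lemma tensor_class_eq_iff:
  fixes s :: "'k::field \<Rightarrow> 'a::ab_group_add \<Rightarrow> 'a" and t :: "'k \<Rightarrow> 'b::ab_group_add \<Rightarrow> 'b"
  shows "tensor_class s t u = tensor_class s t v \<longleftrightarrow> u - v \<in> tensor_null s t"
proof -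
  interpret T: vector_space "fscale :: 'k \<Rightarrow> ('a \<times> 'b \<Rightarrow>\<^sub>0 'k) \<Rightarrow> _" by (rule vector_space_fscale)
  note N = tensor_null_subspace[of s t]
  have "w - u \<in> tensor_null s t \<longleftrightarrow> w - v \<in> tensor_null s t" if "u - v \<in> tensor_null s t" for w
    using T.subspace_add[OF N _ that, of "w - u"] T.subspace_diff[OF N _ that, of "w - v"] by auto
  moreover have "u \<in> tensor_class s t u"
    using T.subspace_0[OF N] by (simp add: tensor_class_def)
  ultimately show ?thesis unfolding tensor_class_def by blast
qed

lemma tensor_rep_class:
  fixes s :: "'k::field \<Rightarrow> 'a::ab_group_add \<Rightarrow> 'a" and t :: "'k \<Rightarrow> 'b::ab_group_add \<Rightarrow> 'b"
  shows "tensor_rep (tensor_class s t u) - u \<in> tensor_null s t"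
proof -
  interpret T: vector_space "fscale :: 'k \<Rightarrow> ('a \<times> 'b \<Rightarrow>\<^sub>0 'k) \<Rightarrow> _" by (rule vector_space_fscale)
  have "u \<in> tensor_class s t u"
    using T.subspace_0[OF tensor_null_subspace[of s t]] by (simp add: tensor_class_def)
  then have "tensor_rep (tensor_class s t u) \<in> tensor_class s t u"
    unfolding tensor_rep_def by (rule someI)
  then show ?thesis by (simp add: tensor_class_def)
qed

lemma lincomb_tensor_rep:
  assumes r: "vector_space r" and F: "bilinear_map s t r F"
  shows "lincomb r (tensor_rep (tensor_class s t u)) (\<lambda>(x, y). F x y) = lincomb r u (\<lambda>(x, y). F x y)"
proof -
  interpret L: Vector_Spaces.linear fscale r "\<lambda>u. lincomb r u (\<lambda>(x, y). F x y)"
    by (rule linear_lincomb[OF r])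
  show ?thesis
    using lincomb_tensor_null[OF r F tensor_rep_class] by (simp add: L.diff)
qed


section \<open>Hopf algebras\<close>

record (overloaded) ('k, 'a) hopf =
  hscale :: "'k::field \<Rightarrow> 'a::ab_group_add \<Rightarrow> 'a"
  hmult :: "'a \<Rightarrow> 'a \<Rightarrow> 'a"
  hone :: 'a
  comult :: "'a \<Rightarrow> ('a \<times> 'a \<Rightarrow>\<^sub>0 'k) set"
  counit :: "'a \<Rightarrow> 'k"
  antipode :: "'a \<Rightarrow> 'a"

text \<open>
  Sweedler notation: \<open>sweedler H s a F\<close> is \<open>F a\<^sub>(\<^sub>1\<^sub>) a\<^sub>(\<^sub>2\<^sub>)\<close>, where \<open>s\<close> is the scaling of the space in
  which \<open>F\<close> takes its values.  The value does not depend on the chosen representative of the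
  coproduct of \<open>a\<close> when \<open>F\<close> is bilinear (also when \<open>F\<close> takes values in formal
  combinations that are afterwards read modulo the tensor relations).
\<close>

definition sweedler ::
  "('k::field, 'a::ab_group_add) hopf \<Rightarrow> ('k \<Rightarrow> 'v \<Rightarrow> 'v) \<Rightarrow> 'a \<Rightarrow> ('a \<Rightarrow> 'a \<Rightarrow> 'v) \<Rightarrow> 'v::ab_group_add" where
  "sweedler H s a F = lincomb s (tensor_rep (comult H a)) (\<lambda>(x, y). F x y)"

definition sweedler3 ::
  "('k::field, 'a::ab_group_add) hopf \<Rightarrow> ('k \<Rightarrow> 'v \<Rightarrow> 'v) \<Rightarrow> 'a \<Rightarrow> ('a \<Rightarrow> 'a \<Rightarrow> 'a \<Rightarrow> 'v)
   \<Rightarrow> 'v::ab_group_add" where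
  "sweedler3 H s a F = sweedler H s a (\<lambda>x z. sweedler H s x (\<lambda>x y. F x y z))"

abbreviation hclass ::
  "('k::field, 'a::ab_group_add) hopf \<Rightarrow> ('a \<times> 'a \<Rightarrow>\<^sub>0 'k) \<Rightarrow> ('a \<times> 'a \<Rightarrow>\<^sub>0 'k) set" where
  "hclass H \<equiv> tensor_class (hscale H) (hscale H)"

locale hopf_algebra =
  fixes H :: "('k::field, 'a::ab_group_add) hopf"
  assumes vector_space: "vector_space (hscale H)"
    and mult_bilinear: "bilinear_map (hscale H) (hscale H) (hscale H) (hmult H)"
    and mult_assoc: "hmult H (hmult H a b) c = hmult H a (hmult H b c)"
    and mult_one_left: "hmult H (hone H) a = a"
    and mult_one_right: "hmult H a (hone H) = a"
    and comult_in: "comult H a \<in> tensor_space (hscale H) (hscale H)"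
    and comult_add:
      "comult H (a + b) = hclass H (tensor_rep (comult H a) + tensor_rep (comult H b))"
    and comult_scale:
      "comult H (hscale H k a) = hclass H (fscale k (tensor_rep (comult H a)))"
    and coassoc:
      "tensor3_class (hscale H)
         (sweedler H fscale a (\<lambda>x z. sweedler H fscale x (\<lambda>x y. basis (x, y, z)))) =
       tensor3_class (hscale H)
         (sweedler H fscale a (\<lambda>x y. sweedler H fscale y (\<lambda>y z. basis (x, y, z))))"
    and counit_linear: "Vector_Spaces.linear (hscale H) (*) (counit H)"
    and counit_left: "sweedler H (hscale H) a (\<lambda>x y. hscale H (counit H x) y) = a"
    and counit_right: "sweedler H (hscale H) a (\<lambda>x y. hscale H (counit H y) x) = a"
    and comult_mult:
      "comult H (hmult H a b) =
         hclass H (sweedler H fscale a (\<lambda>x y. sweedler H fscale b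
           (\<lambda>x' y'. basis (hmult H x x', hmult H y y'))))"
    and comult_one: "comult H (hone H) = hclass H (basis (hone H, hone H))"
    and counit_mult: "counit H (hmult H a b) = counit H a * counit H b"
    and counit_one: "counit H (hone H) = 1"
    and antipode_linear: "Vector_Spaces.linear (hscale H) (hscale H) (antipode H)"
    and antipode_left:
      "sweedler H (hscale H) a (\<lambda>x y. hmult H (antipode H x) y) = hscale H (counit H a) (hone H)"
    and antipode_right:
      "sweedler H (hscale H) a (\<lambda>x y. hmult H x (antipode H y)) = hscale H (counit H a) (hone H)"

definition hopf_hom ::
  "('k::field, 'a::ab_group_add) hopf \<Rightarrow> ('k, 'b::ab_group_add) hopf \<Rightarrow> ('a \<Rightarrow> 'b) \<Rightarrow> bool" where
  "hopf_hom H H' f \<longleftrightarrow>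
     Vector_Spaces.linear (hscale H) (hscale H') f \<and>
     (\<forall>a b. f (hmult H a b) = hmult H' (f a) (f b)) \<and>
     f (hone H) = hone H' \<and>
     (\<forall>a. comult H' (f a) = hclass H' (sweedler H fscale a (\<lambda>x y. basis (f x, f y)))) \<and>
     (\<forall>a. counit H' (f a) = counit H a) \<and>
     (\<forall>a. f (antipode H a) = antipode H' (f a))"

definition hopf_subalgebra :: "('k::field, 'a::ab_group_add) hopf \<Rightarrow> 'a set \<Rightarrow> bool" where
  "hopf_subalgebra H B \<longleftrightarrow>
     module.subspace (hscale H) B \<and> hone H \<in> B \<and>
     (\<forall>a\<in>B. \<forall>b\<in>B. hmult H a b \<in> B) \<and>
     (\<forall>a\<in>B. \<exists>u. Poly_Mapping.keys u \<subseteq> B \<times> B \<and> comult H a = hclass H u) \<and>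
     (\<forall>a\<in>B. antipode H a \<in> B)"

definition hopf_iso_onto ::
  "('k::field, 'a::ab_group_add) hopf \<Rightarrow> ('k, 'b::ab_group_add) hopf \<Rightarrow> 'b set \<Rightarrow> ('a \<Rightarrow> 'b) \<Rightarrow> bool" where
  "hopf_iso_onto H H' B f \<longleftrightarrow>
     hopf_algebra H \<and> hopf_algebra H' \<and> hopf_subalgebra H' B \<and>
     hopf_hom H H' f \<and> inj f \<and> range f = B"


section \<open>Group algebras and cocentral actions\<close>

text \<open>
  A (not necessarily commutative) group is a type of class \<^class>\<open>group_add\<close>, so the group law is
  written \<open>+\<close> and the identity \<open>0\<close>.  The product and unit of \<^typ>\<open>'g::group_add \<Rightarrow>\<^sub>0 'k::field\<close>
  provided by the library are those of the group algebra.
\<close>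

definition group_algebra :: "('k::field, 'g::group_add \<Rightarrow>\<^sub>0 'k) hopf" where
  "group_algebra =
     \<lparr>hscale = fscale,
      hmult = (*),
      hone = 1,
      comult = (\<lambda>x. tensor_class fscale fscale (lincomb fscale x (\<lambda>g. basis (basis g, basis g)))),
      counit = (\<lambda>x. lincomb (*) x (\<lambda>g. 1)),
      antipode = (\<lambda>x. lincomb fscale x (\<lambda>g. basis (- g)))\<rparr>"

definition cocentral ::
  "('k::field, 'a::ab_group_add) hopf \<Rightarrow> ('a \<Rightarrow> ('g::group_add \<Rightarrow>\<^sub>0 'k)) \<Rightarrow> bool" where
  "cocentral A p \<longleftrightarrow>
     (\<forall>a. tensor_class fscale (hscale A) (sweedler A fscale a (\<lambda>x y. basis (p x, y))) =
          tensor_class fscale (hscale A) (sweedler A fscale a (\<lambda>x y. basis (p y, x))))"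

definition invariant_cocentral_action ::
  "('k::field, 'a::ab_group_add) hopf \<Rightarrow> ('a \<Rightarrow> ('g::group_add \<Rightarrow>\<^sub>0 'k)) \<Rightarrow> ('g \<Rightarrow> 'a \<Rightarrow> 'a) \<Rightarrow> bool" where
  "invariant_cocentral_action A p \<alpha> \<longleftrightarrow>
     hopf_hom A group_algebra p \<and> cocentral A p \<and>
     (\<forall>g. hopf_hom A A (\<alpha> g) \<and> bij (\<alpha> g)) \<and>
     (\<forall>a. \<alpha> 0 a = a) \<and> (\<forall>g h a. \<alpha> (g + h) a = \<alpha> g (\<alpha> h a)) \<and>
     (\<forall>g a. p (\<alpha> g a) = p a)"

text \<open>
  \<open>A \<otimes> K\<Gamma>\<close> is realised as \<open>'g \<Rightarrow>\<^sub>0 'a\<close>: the elementary tensor \<open>a \<otimes> x\<close> is the map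
  \<open>g \<mapsto> x\<^sub>g a\<close>, and in particular \<open>a \<otimes> g\<close> is \<open>Poly_Mapping.single g a\<close>.  Lemma
  \<open>tensor_group_algebra_bij\<close> below identifies this with the tensor product defined above.
\<close>

definition gtensor ::
  "('k::field, 'a::ab_group_add) hopf \<Rightarrow> 'a \<Rightarrow> ('g \<Rightarrow>\<^sub>0 'k) \<Rightarrow> ('g \<Rightarrow>\<^sub>0 'a)" where
  "gtensor A a x = Poly_Mapping.map (\<lambda>c. hscale A c a) x"

lemma lookup_gtensor:
  assumes "vector_space (hscale A)"
  shows "Poly_Mapping.lookup (gtensor A a x) g = hscale A (Poly_Mapping.lookup x g) a"
proof -
  interpret vector_space "hscale A" by fact
  show ?thesis by (simp add: gtensor_def Poly_Mapping.map.rep_eq when_def)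
qed

lemma gtensor_basis: "vector_space (hscale A) \<Longrightarrow> gtensor A a (basis g) = Poly_Mapping.single g a"
  by (rule poly_mapping_eqI)
    (simp add: lookup_gtensor lookup_single when_def vector_space_def vector_space.scale_eq_0_iff)

lemma bilinear_gtensor:
  fixes A :: "('k::field, 'a::ab_group_add) hopf"
  assumes "vector_space (hscale A)"
  shows "bilinear_map (hscale A) fscale (pm_scale (hscale A))
    (gtensor A :: 'a \<Rightarrow> ('g \<Rightarrow>\<^sub>0 'k) \<Rightarrow> _)"
proof -
  interpret A: vector_space "hscale A" by fact
  interpret T: vector_space "fscale :: 'k \<Rightarrow> ('g \<Rightarrow>\<^sub>0 'k) \<Rightarrow> _" by (rule vector_space_fscale)
  interpret P: vector_space "pm_scale (hscale A) :: 'k \<Rightarrow> ('g \<Rightarrow>\<^sub>0 'a) \<Rightarrow> _"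
    by (rule vector_space_pm_scale) fact
  show ?thesis
    unfolding bilinear_map_def
    by (intro conjI allI; unfold_locales)
      (rule poly_mapping_eqI, simp add: lookup_gtensor[OF assms] lookup_add lookup_pm_scale
         A.scale_right_distrib A.scale_left_distrib mult.commute)+
qed

text \<open>
  The linear map \<open>A \<otimes> K\<Gamma> \<rightarrow> ('g \<Rightarrow>\<^sub>0 'a)\<close> induced by the bilinear map \<^const>\<open>gtensor\<close> is an
  isomorphism.
\<close>

lemma tensor_group_algebra_bij:
  fixes A :: "('k::field, 'a::ab_group_add) hopf"
  assumes A: "vector_space (hscale A)"
  shows "bij_betw (\<lambda>T. lincomb (pm_scale (hscale A)) (tensor_rep T) (\<lambda>(a, x). gtensor A a x))
           (tensor_space (hscale A) fscale) (UNIV :: ('g::group_add \<Rightarrow>\<^sub>0 'a) set)"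
proof -
  let ?s = "pm_scale (hscale A) :: 'k \<Rightarrow> ('g \<Rightarrow>\<^sub>0 'a) \<Rightarrow> _"
  let ?N = "tensor_null (hscale A) (fscale :: 'k \<Rightarrow> ('g \<Rightarrow>\<^sub>0 'k) \<Rightarrow> _)"
  let ?G = "\<lambda>(a, x :: 'g \<Rightarrow>\<^sub>0 'k). gtensor A a x"
  let ?L = "\<lambda>u. lincomb ?s u ?G"
  interpret A: vector_space "hscale A" by fact
  interpret K: vector_space "fscale :: 'k \<Rightarrow> ('g \<Rightarrow>\<^sub>0 'k) \<Rightarrow> _" by (rule vector_space_fscale)
  interpret T: vector_space "fscale :: 'k \<Rightarrow> ('a \<times> ('g \<Rightarrow>\<^sub>0 'k) \<Rightarrow>\<^sub>0 'k) \<Rightarrow> _"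
    by (rule vector_space_fscale)
  have s: "vector_space ?s" by (rule vector_space_pm_scale[OF A])
  interpret L: Vector_Spaces.linear fscale ?s ?L by (rule linear_lincomb[OF s])
  note N = tensor_null_subspace[of "hscale A" "fscale :: 'k \<Rightarrow> ('g \<Rightarrow>\<^sub>0 'k) \<Rightarrow> _"]
  have rep: "lincomb ?s (tensor_rep (tensor_class (hscale A) fscale u)) ?G = ?L u" for u
    by (rule lincomb_tensor_rep[OF s bilinear_gtensor[OF A]])
  define R :: "('g \<Rightarrow>\<^sub>0 'a) \<Rightarrow> ('a \<times> ('g \<Rightarrow>\<^sub>0 'k) \<Rightarrow>\<^sub>0 'k)" where "R w = (\<Sum>g\<in>Poly_Mapping.keys w. basis (Poly_Mapping.lookup w g, basis g) :: _ \<Rightarrow>\<^sub>0 'k)"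
    for w :: "'g \<Rightarrow>\<^sub>0 'a"
  have gen_add: "basis (x + x', y) - basis (x, y) - basis (x', y) \<in> ?N"
    and gen_add2: "basis (x, y + y') - basis (x, y) - basis (x, y') \<in> ?N"
    and gen_scale: "basis (hscale A c x, y) - fscale c (basis (x, y)) \<in> ?N"
    and gen_scale2: "basis (x, fscale c y) - fscale c (basis (x, y)) \<in> ?N" for x x' y y' c
    unfolding tensor_null_def by (rule T.span_base; blast)+
  have neg: "u \<in> ?N \<Longrightarrow> - u \<in> ?N" for u by (rule T.subspace_neg[OF N])
  have gen0: "basis (0, y) \<in> ?N" for y
    using neg[OF gen_add[of 0 0 y]] by simp
  have gen02: "basis (x, 0) \<in> ?N" for x
    using neg[OF gen_add2[of x 0 0]] by simp
  have R_sup: "(\<Sum>g\<in>X. basis (Poly_Mapping.lookup w g, basis g)) - R w \<in> ?N"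
    if "finite X" "Poly_Mapping.keys w \<subseteq> X" for X w
  proof -
    have "(\<Sum>g\<in>X. basis (Poly_Mapping.lookup w g, basis g)) - R w =
        (\<Sum>g\<in>X - Poly_Mapping.keys w. basis (Poly_Mapping.lookup w g, basis g))"
      using sum.subset_diff[OF that(2,1), of "\<lambda>g. basis (Poly_Mapping.lookup w g, basis g :: 'g \<Rightarrow>\<^sub>0 'k) :: _ \<Rightarrow>\<^sub>0 'k"]
      by (simp add: R_def)
    also have "\<dots> \<in> ?N"
      by (rule T.subspace_sum[OF N]) (simp add: in_keys_iff gen0)
    finally show ?thesis .
  qed
  have R_add: "R (v + w) - (R v + R w) \<in> ?N" for v w
  proof -
    let ?X = "Poly_Mapping.keys v \<union> Poly_Mapping.keys w"
    let ?S = "\<lambda>w. \<Sum>g\<in>?X. basis (Poly_Mapping.lookup w g, basis g)"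
    have d: "?S (v + w) - ?S v - ?S w \<in> ?N"
      unfolding sum_subtractf[symmetric] lookup_add
      by (rule T.subspace_sum[OF N]) (rule gen_add)
    have "?S (v + w) - R (v + w) \<in> ?N" "?S v - R v \<in> ?N" "?S w - R w \<in> ?N"
      using keys_add[of v w] by (intro R_sup; auto)+
    from T.subspace_add[OF N T.subspace_diff[OF N d this(1)] T.subspace_add[OF N this(2,3)]]
    have "(?S (v + w) - ?S v - ?S w) - (?S (v + w) - R (v + w))
        + ((?S v - R v) + (?S w - R w)) \<in> ?N" .
    then show ?thesis by (simp add: algebra_simps)
  qed
  have R_scale: "R (?s c w) - fscale c (R w) \<in> ?N" for c w
  proof -
    let ?X = "Poly_Mapping.keys w"
    let ?S = "\<lambda>w. \<Sum>g\<in>?X. basis (Poly_Mapping.lookup w g, basis g)"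
    have "?S (?s c w) - fscale c (?S w) \<in> ?N"
      unfolding sum_subtractf[symmetric] T.scale_sum_right lookup_pm_scale[of "hscale A", OF A.scale_zero_right]
      by (rule T.subspace_sum[OF N]) (rule gen_scale)
    moreover have "?S (?s c w) - R (?s c w) \<in> ?N"
      by (intro R_sup) (auto simp: in_keys_iff lookup_pm_scale)
    ultimately have "(?S (?s c w) - fscale c (?S w)) - (?S (?s c w) - R (?s c w)) \<in> ?N"
      by (rule T.subspace_diff[OF N])
    then show ?thesis by (simp add: R_def)
  qed
  have R_gtensor: "R (gtensor A a x) - basis (a, x) \<in> ?N" for a x
  proof -
    let ?X = "Poly_Mapping.keys x"
    have n1: "(\<Sum>g\<in>?X. basis (Poly_Mapping.lookup (gtensor A a x) g, basis g)) - R (gtensor A a x) \<in> ?N"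
      by (intro R_sup) (auto simp: in_keys_iff lookup_gtensor[OF A])
    have n2: "(\<Sum>g\<in>?X. basis (Poly_Mapping.lookup (gtensor A a x) g, basis g))
        - (\<Sum>g\<in>?X. fscale (Poly_Mapping.lookup x g) (basis (a, basis g))) \<in> ?N"
      unfolding sum_subtractf[symmetric] lookup_gtensor[OF A]
      by (rule T.subspace_sum[OF N]) (rule gen_scale)
    have "basis (a, \<Sum>g\<in>Y. fscale (f g) (basis g))
        - (\<Sum>g\<in>Y. fscale (f g) (basis (a, basis g))) \<in> ?N" if "finite Y" for Y :: "'g set" and f
      using that
    proof induction
      case empty
      then show ?case by (simp add: gen02)
    next
      case (insert g Y)
      from T.subspace_add[OF N T.subspace_add[OF N insert.IH gen_scale2[of a "f g" "basis g"]]
          gen_add2[of a "fscale (f g) (basis g)" "\<Sum>g\<in>Y. fscale (f g) (basis g)"]]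
      show ?case using insert.hyps by (simp add: algebra_simps)
    qed
    from this[of ?X "Poly_Mapping.lookup x"]
    have n3: "basis (a, x) - (\<Sum>g\<in>?X. fscale (Poly_Mapping.lookup x g) (basis (a, basis g))) \<in> ?N"
      using lincomb_basis_self[of x] by (simp add: lincomb_def)
    from T.subspace_diff[OF N T.subspace_diff[OF N n2 n1] n3]
    show ?thesis by simp
  qed
  have R_sum: "R (sum h Y) - (\<Sum>y\<in>Y. R (h y)) \<in> ?N" for h :: "'a \<times> ('g \<Rightarrow>\<^sub>0 'k) \<Rightarrow> _" and Y
  proof (induction Y rule: infinite_finite_induct)
    case (insert y Y)
    from T.subspace_add[OF N insert.IH R_add[of "h y" "sum h Y"]]
    show ?case using insert.hyps by (simp add: algebra_simps)
  qed (simp_all add: R_def T.subspace_0[OF N])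
  have RL: "R (?L u) - u \<in> ?N" for u
  proof -
    let ?X = "Poly_Mapping.keys u" and ?c = "Poly_Mapping.lookup u"
    have n1: "R (?L u) - (\<Sum>y\<in>?X. R (?s (?c y) (?G y))) \<in> ?N"
      unfolding lincomb_def by (rule R_sum)
    have n2: "(\<Sum>y\<in>?X. R (?s (?c y) (?G y))) - (\<Sum>y\<in>?X. fscale (?c y) (R (?G y))) \<in> ?N"
      unfolding sum_subtractf[symmetric] by (rule T.subspace_sum[OF N]) (rule R_scale)
    have n3: "(\<Sum>y\<in>?X. fscale (?c y) (R (?G y))) - (\<Sum>y\<in>?X. fscale (?c y) (basis y)) \<in> ?N"
      unfolding sum_subtractf[symmetric] T.scale_right_diff_distrib[symmetric]
      by (rule T.subspace_sum[OF N], rule T.subspace_scale[OF N]) (auto simp: R_gtensor)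
    from T.subspace_add[OF N T.subspace_add[OF N n1 n2] n3]
    have "R (?L u) - (\<Sum>y\<in>?X. fscale (?c y) (basis y)) \<in> ?N"
      by simp
    then show ?thesis
      using lincomb_basis_self[of u] by (simp add: lincomb_def)
  qed
  have LR: "?L (R w) = w" for w
  proof -
    have "?L (R w) = (\<Sum>g\<in>Poly_Mapping.keys w. Poly_Mapping.single g (Poly_Mapping.lookup w g))"
      unfolding R_def L.sum by (simp add: lincomb_basis[OF s] gtensor_basis[OF A])
    also have "\<dots> = w"
      by (rule poly_mapping_eqI)
        (simp add: lookup_sum lookup_single when_def sum.delta in_keys_iff)
    finally show ?thesis .
  qed
  show ?thesis
  proof (rule bij_betwI')
    fix T U assume "T \<in> tensor_space (hscale A) (fscale :: 'k \<Rightarrow> ('g \<Rightarrow>\<^sub>0 'k) \<Rightarrow> _)"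
      and "U \<in> tensor_space (hscale A) (fscale :: 'k \<Rightarrow> ('g \<Rightarrow>\<^sub>0 'k) \<Rightarrow> _)"
    then obtain u v where T: "T = tensor_class (hscale A) fscale u"
      and U: "U = tensor_class (hscale A) fscale v" by (auto simp: tensor_space_def)
    have "u - v \<in> ?N" if "?L u = ?L v"
      using T.subspace_diff[OF N RL[of v] RL[of u]] that by simp
    moreover have "?L u = ?L v" if "u - v \<in> ?N"
      using lincomb_tensor_null[OF s bilinear_gtensor[OF A] that] by (simp add: L.diff)
    ultimately show "(?L (tensor_rep T) = ?L (tensor_rep U)) = (T = U)"
      unfolding T U rep tensor_class_eq_iff by blast
  next
    fix w
    show "\<exists>T\<in>tensor_space (hscale A) fscale. w = ?L (tensor_rep T)"
      by (rule bexI[of _ "tensor_class (hscale A) fscale (R w)"])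
        (simp_all add: tensor_space_def rep LR)
  qed simp
qed

definition component ::
  "('k::field, 'a::ab_group_add) hopf \<Rightarrow> ('a \<Rightarrow> ('g \<Rightarrow>\<^sub>0 'k)) \<Rightarrow> 'g \<Rightarrow> 'a set" where
  "component A p g =
     {a. sweedler A (pm_scale (hscale A)) a (\<lambda>x y. gtensor A x (p y)) = gtensor A a (basis g)}"

definition crossed_product ::
  "('k::field, 'a::ab_group_add) hopf \<Rightarrow> ('g::group_add \<Rightarrow> 'a \<Rightarrow> 'a) \<Rightarrow> ('k, 'g \<Rightarrow>\<^sub>0 'a) hopf" where
  "crossed_product A \<alpha> =
     \<lparr>hscale = pm_scale (hscale A),
      hmult = (\<lambda>u v. \<Sum>g\<in>Poly_Mapping.keys u. \<Sum>h\<in>Poly_Mapping.keys v.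
         Poly_Mapping.single (g + h)
           (hmult A (Poly_Mapping.lookup u g) (\<alpha> g (Poly_Mapping.lookup v h)))),
      hone = Poly_Mapping.single 0 (hone A),
      comult = (\<lambda>u. tensor_class (pm_scale (hscale A)) (pm_scale (hscale A))
         (\<Sum>g\<in>Poly_Mapping.keys u. sweedler A fscale (Poly_Mapping.lookup u g)
            (\<lambda>x y. basis (Poly_Mapping.single g x, Poly_Mapping.single g y)))),
      counit = (\<lambda>u. \<Sum>g\<in>Poly_Mapping.keys u. counit A (Poly_Mapping.lookup u g)),
      antipode = (\<lambda>u. \<Sum>g\<in>Poly_Mapping.keys u.
         Poly_Mapping.single (- g) (antipode A (\<alpha> (- g) (Poly_Mapping.lookup u g))))\<rparr>"

definition graded_twisting ::
  "('k::field, 'a::ab_group_add) hopf \<Rightarrow> ('a \<Rightarrow> ('g::group_add \<Rightarrow>\<^sub>0 'k)) \<Rightarrow> ('g \<Rightarrow> 'a \<Rightarrow> 'a)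
   \<Rightarrow> ('g \<Rightarrow>\<^sub>0 'a) set" where
  "graded_twisting A p \<alpha> =
     module.span (hscale (crossed_product A \<alpha>))
       {Poly_Mapping.single g a | g a. a \<in> component A p g}"


section \<open>Almost adjoint actions\<close>

definition conv ::
  "('k::field, 'a::ab_group_add) hopf \<Rightarrow> ('a \<Rightarrow> 'k) \<Rightarrow> ('a \<Rightarrow> 'k) \<Rightarrow> ('a \<Rightarrow> 'k)" where
  "conv A \<mu> \<nu> = (\<lambda>a. sweedler A (*) a (\<lambda>x y. \<mu> x * \<nu> y))"

definition H1 :: "('k::field, 'a::ab_group_add) hopf \<Rightarrow> ('a \<Rightarrow> 'k) monoid" where
  "H1 A =
     \<lparr>carrier = {\<omega>. Vector_Spaces.linear (hscale A) (*) \<omega> \<and>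
                   (\<forall>a b. \<omega> (hmult A a b) = \<omega> a * \<omega> b) \<and> \<omega> (hone A) = 1},
      mult = conv A,
      one = counit A\<rparr>"

definition H1_ell :: "('k::field, 'a::ab_group_add) hopf \<Rightarrow> ('a \<Rightarrow> 'k) set" where
  "H1_ell A = {\<omega> \<in> carrier (H1 A). \<forall>a.
     sweedler A (hscale A) a (\<lambda>x y. hscale A (\<omega> x) y) =
     sweedler A (hscale A) a (\<lambda>x y. hscale A (\<omega> y) x)}"

definition almost_adjoint ::
  "('k::field, 'a::ab_group_add) hopf \<Rightarrow> ('g::group_add \<Rightarrow> 'a \<Rightarrow> 'a) \<Rightarrow> ('g \<Rightarrow> 'a \<Rightarrow> 'k) \<Rightarrow>
   ('g \<Rightarrow> 'g \<Rightarrow> 'a \<Rightarrow> 'k) \<Rightarrow> bool" where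
  "almost_adjoint A \<alpha> \<phi> \<mu> \<longleftrightarrow>
     (\<forall>g. \<phi> g \<in> carrier (H1 A)) \<and>
     (\<forall>g h. \<mu> g h \<in> H1_ell A) \<and>
     (\<forall>g h k. \<mu> g h \<otimes>\<^bsub>H1 A\<^esub> \<mu> (g + h) k = \<mu> h k \<otimes>\<^bsub>H1 A\<^esub> \<mu> g (h + k)) \<and>
     \<phi> 0 = \<one>\<^bsub>H1 A\<^esub> \<and>
     (\<forall>g h. \<phi> g \<otimes>\<^bsub>H1 A\<^esub> \<phi> h = \<phi> (g + h) \<otimes>\<^bsub>H1 A\<^esub> \<mu> g h \<and>
            \<phi> (g + h) \<otimes>\<^bsub>H1 A\<^esub> \<mu> g h = \<mu> g h \<otimes>\<^bsub>H1 A\<^esub> \<phi> (g + h)) \<and>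
     (\<forall>g a. \<alpha> g a = sweedler3 A (hscale A) a
        (\<lambda>x y z. hscale A ((inv\<^bsub>H1 A\<^esub> (\<phi> g)) x * \<phi> g z) y))"

definition linear_extension ::
  "('g \<Rightarrow> 'a \<Rightarrow> 'k::field) \<Rightarrow> ('g \<Rightarrow>\<^sub>0 'k) \<Rightarrow> ('a \<Rightarrow> 'k)" where
  "linear_extension \<psi> x = (\<lambda>b. lincomb (*) x (\<lambda>g. \<psi> g b))"


section \<open>Pseudo-2-cocycles\<close>

text \<open>Linear functionals on \<open>A \<otimes> A\<close> are given as bilinear forms on \<open>A\<close>.\<close>

definition bilinear_form ::
  "('k::field, 'a::ab_group_add) hopf \<Rightarrow> ('a \<Rightarrow> 'a \<Rightarrow> 'k) \<Rightarrow> bool" where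
  "bilinear_form A \<sigma> \<longleftrightarrow> bilinear_map (hscale A) (hscale A) (*) \<sigma>"

definition conv2 ::
  "('k::field, 'a::ab_group_add) hopf \<Rightarrow> ('a \<Rightarrow> 'a \<Rightarrow> 'k) \<Rightarrow> ('a \<Rightarrow> 'a \<Rightarrow> 'k) \<Rightarrow> ('a \<Rightarrow> 'a \<Rightarrow> 'k)" where
  "conv2 A \<sigma> \<tau> = (\<lambda>a b. sweedler A (*) a (\<lambda>x x'. sweedler A (*) b (\<lambda>y y'. \<sigma> x y * \<tau> x' y')))"

definition conv2_inverse ::
  "('k::field, 'a::ab_group_add) hopf \<Rightarrow> ('a \<Rightarrow> 'a \<Rightarrow> 'k) \<Rightarrow> ('a \<Rightarrow> 'a \<Rightarrow> 'k) \<Rightarrow> bool" where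
  "conv2_inverse A \<sigma> \<tau> \<longleftrightarrow>
     bilinear_form A \<sigma> \<and> bilinear_form A \<tau> \<and>
     conv2 A \<sigma> \<tau> = (\<lambda>a b. counit A a * counit A b) \<and>
     conv2 A \<tau> \<sigma> = (\<lambda>a b. counit A a * counit A b)"

definition twisted_mult ::
  "('k::field, 'a::ab_group_add) hopf \<Rightarrow> ('a \<Rightarrow> 'a \<Rightarrow> 'k) \<Rightarrow> 'a \<Rightarrow> 'a \<Rightarrow> 'a" where
  "twisted_mult A \<sigma> a b =
     sweedler3 A (hscale A) a (\<lambda>a1 a2 a3. sweedler3 A (hscale A) b (\<lambda>b1 b2 b3.
       hscale A (\<sigma> a1 b1 * (THE \<tau>. conv2_inverse A \<sigma> \<tau>) a3 b3) (hmult A a2 b2)))"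

text \<open>
  The twisted Hopf algebra keeps the unit, the coproduct and hence the counit; its antipode is
  uniquely determined.
\<close>

definition pseudo_2_cocycle ::
  "('k::field, 'a::ab_group_add) hopf \<Rightarrow> ('a \<Rightarrow> 'a \<Rightarrow> 'k) \<Rightarrow> bool" where
  "pseudo_2_cocycle A \<sigma> \<longleftrightarrow>
     (\<exists>\<tau>. conv2_inverse A \<sigma> \<tau>) \<and>
     (\<exists>S. hopf_algebra (A\<lparr>hmult := twisted_mult A \<sigma>, antipode := S\<rparr>))"

definition twist ::
  "('k::field, 'a::ab_group_add) hopf \<Rightarrow> ('a \<Rightarrow> 'a \<Rightarrow> 'k) \<Rightarrow> ('k, 'a) hopf" where
  "twist A \<sigma> =
     A\<lparr>hmult := twisted_mult A \<sigma>,
       antipode := (THE S. hopf_algebra (A\<lparr>hmult := twisted_mult A \<sigma>, antipode := S\<rparr>))\<rparr>"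

end

theory Submission
  imports Defs
begin

text \<open>
  By cocentrality \<open>A = \<Oplus>\<^sub>g A\<^sub>g\<close> is a decomposition into subcoalgebras: for \<open>a \<in> A\<^sub>g\<close> both legs of the
  coproduct may be taken in \<open>A\<^sub>g\<close>, \<open>p(a) = \<epsilon>(a) g\<close>, and \<open>j(a) = a \<otimes> g\<close>.  Hence
  \<open>\<sigma>(a, b) = \<epsilon>(a) \<phi>\<^sub>g\<^sup>-\<^sup>1(b)\<close>, which makes the convolution inverse of \<open>\<sigma>\<close> evident and turns the twisted
  product into \<open>a \<cdot> b = a \<alpha>\<^sub>g(b)\<close>.  With \<open>A\<^sub>g A\<^sub>h \<subseteq> A\<^sub>g\<^sub>h\<close>, \<open>\<alpha>\<^sub>h(A\<^sub>g) = A\<^sub>g\<close> and \<open>S(A\<^sub>g) \<subseteq> A\<^sub>-\<^sub>g\<close> the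
  Hopf algebra axioms for this product, with antipode \<open>a \<mapsto> S(\<alpha>\<^sub>g\<^sup>-\<^sup>1(a))\<close> on \<open>A\<^sub>g\<close>, and the compatibility of
  \<open>j\<close> with all structure maps can be read off on homogeneous elements.
\<close>

section \<open>Multilinear maps\<close>

text \<open>A tensor is a coset and a Sweedler sum is a finite sum over one chosen representative,
  so identities of tensors cannot be read off termwise. Linear functionals separate points from
  subspaces; hence two tensors agree once all scalar bilinear (or trilinear) forms agree on them,
  and every coproduct axiom is checked as a scalar identity for an arbitrary form. The product
  \<open>tmult\<close> and antipode \<open>tantipode\<close> are defined from the grading and
  \<alpha> alone, as crossed product operations pulled back along j. The Hopf axioms and the
  isomorphism are proved for them; \<phi> enters only when \<open>twisted_mult\<close> is identified
  with \<open>tmult\<close>. That works because the three legs of an element of degree g again have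
  degree g, so \<phi>_g and its inverse surround the second factor with one common index g. Inverses
  and antipodes given by definite descriptions are pinned down by the uniqueness of inverses under
  convolution.\<close>

text \<open>
  Used with \<open>intro\<close>, these rules prove linearity in a variable of an expression in which that
  variable occurs exactly once.
\<close>

named_theorems multilinear

abbreviation linear_map where "linear_map \<equiv> Vector_Spaces.linear"

lemmas linear_map_iff = Vector_Spaces.linear_iff

lemma linear_mapI:
  assumes "vector_space s" "vector_space t" "\<And>x y. f (x + y) = f x + f y"
    "\<And>c x. f (s c x) = t c (f x)"
  shows "linear_map s t f"
  using assms by (simp add: linear_map_iff)

lemma
  assumes "linear_map s t f"
  shows linear_map_add: "f (x + y) = f x + f y" and linear_map_scale: "f (s c x) = t c (f x)"
    and linear_map_0: "f 0 = 0" and linear_map_diff: "f (x - y) = f x - f y"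
    and linear_map_sum: "f (sum h I) = (\<Sum>i\<in>I. f (h i))"
proof -
  interpret Vector_Spaces.linear s t f by fact
  show "f (x + y) = f x + f y" "f (s c x) = t c (f x)" "f 0 = 0" "f (x - y) = f x - f y"
    "f (sum h I) = (\<Sum>i\<in>I. f (h i))"
    by (auto simp: add scale zero diff sum)
qed

lemma linear_map_compose:
  assumes "linear_map r s f" "linear_map s t g"
  shows "linear_map r t (\<lambda>x. g (f x))"
  using assms by (simp add: linear_map_iff)

lemma linear_map_ident [multilinear]: "vector_space s \<Longrightarrow> linear_map s s (\<lambda>x. x)"
  by (simp add: linear_map_iff)

lemma linear_map_const_0 [multilinear]:
  "vector_space s \<Longrightarrow> vector_space t \<Longrightarrow> linear_map s t (\<lambda>x. 0)"
  by (simp add: linear_map_iff module.scale_zero_right flip: module_iff_vector_space)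

lemma linear_map_plus [multilinear]:
  "linear_map s t f \<Longrightarrow> linear_map s t g \<Longrightarrow> linear_map s t (\<lambda>x. f x + g x)"
  by (simp add: linear_map_iff vector_space_def)

lemma linear_map_sum_fun [multilinear]:
  assumes "vector_space s" "vector_space t" "\<And>i. i \<in> I \<Longrightarrow> linear_map s t (f i)"
  shows "linear_map s t (\<lambda>x. \<Sum>i\<in>I. f i x)"
  using assms by (induction I rule: infinite_finite_induct) (auto intro!: multilinear)

lemma linear_map_scale_vector:
  assumes "vector_space t" "linear_map s (*) f"
  shows "linear_map s t (\<lambda>x. t (f x) v)"
proof -
  interpret vector_space t by fact
  show ?thesis using assms by (auto simp: linear_map_iff scale_left_distrib)
qed

lemma linear_map_scale_scalar:
  assumes "linear_map s t f"
  shows "linear_map s t (\<lambda>x. t c (f x))"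
proof -
  interpret vector_space t using assms by (simp add: linear_map_iff)
  show ?thesis using assms by (auto simp: linear_map_iff scale_right_distrib scale_left_commute)
qed

lemma linear_map_mult_left [multilinear]:
  fixes f :: "_ \<Rightarrow> 'k::field"
  shows "linear_map s (*) f \<Longrightarrow> linear_map s (*) (\<lambda>x. f x * c)"
    "linear_map s (*) f \<Longrightarrow> linear_map s (*) (\<lambda>x. c * f x)"
  by (rule linear_map_scale_vector[OF vector_space_mult] linear_map_scale_scalar; assumption)+

lemmas [multilinear] = vector_space_mult vector_space_fscale
  linear_map_scale_vector[where t = "hscale H" for H] linear_map_scale_scalar[where t = "hscale H" for H]
  linear_map_scale_vector[where t = "pm_scale r" for r] linear_map_scale_scalar[where t = "pm_scale r" for r]

lemma bilinear_mapI:
  assumes "\<And>x. linear_map t r (\<lambda>y. F x y)" "\<And>y. linear_map s r (\<lambda>x. F x y)"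
  shows "bilinear_map s t r F"
  using assms by (simp add: bilinear_map_def)

text \<open>Phrased for an argument \<open>f x\<close> instead of \<open>x\<close>, so that as an
  introduction rule it passes from a bilinear expression to the argument containing the
  variable.\<close>

lemma bilinear_mapD:
  assumes "bilinear_map s t r F"
  shows "linear_map q t f \<Longrightarrow> linear_map q r (\<lambda>x. F a (f x))"
    "linear_map q s g \<Longrightarrow> linear_map q r (\<lambda>x. F (g x) b)"
  using assms unfolding bilinear_map_def by (auto intro: linear_map_compose)

section \<open>Separating tensors by multilinear forms\<close>

text \<open>If w lay outside the span, a maximal independent subset B of G would stay independent
  after adjoining w, and a functional that is 1 at w and 0 on B would kill G but not w.\<close>

lemma span_separation:
  fixes s :: "'k::field \<Rightarrow> 'v::ab_group_add \<Rightarrow> 'v"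
  assumes s: "vector_space s" and w: "\<And>L. linear_map s (*) L \<Longrightarrow> (\<And>x. x \<in> G \<Longrightarrow> L x = 0) \<Longrightarrow> L w = 0"
  shows "w \<in> module.span s G"
proof (rule ccontr)
  interpret S: vector_space s by fact
  interpret P: vector_space_pair s "(*) :: 'k \<Rightarrow> 'k \<Rightarrow> 'k"
    using s vector_space_mult by (simp add: vector_space_pair_def)
  assume nw: "w \<notin> S.span G"
  obtain B where B: "B \<subseteq> G" "S.independent B" "G \<subseteq> S.span B"
    using S.maximal_independent_subset[of G] by blast
  have span: "S.span B = S.span G"
    using B by (metis S.span_eq S.span_superset subset_trans)
  then have "S.independent (insert w B)"
    using B nw by (simp add: S.independent_insert)
  from P.linear_independent_extend[OF this, of "\<lambda>x. if x = w then 1 else 0"]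
  obtain L where L: "linear_map s (*) L" "\<And>x. x \<in> insert w B \<Longrightarrow> L x = (if x = w then 1 else 0)"
    by blast
  have wB: "w \<notin> B" using nw span S.span_superset[of B] by auto
  have "L x = 0" if "x \<in> S.span B" for x
    using that
  proof (rule S.span_induct)
    show "S.subspace {x. L x = 0}"
      using L(1) by (auto simp: S.subspace_def linear_map_0 linear_map_add linear_map_scale)
    show "L x = 0" if "x \<in> B" for x using L(2)[of x] that wB by auto
  qed
  then have "L w = 0" using w[OF L(1)] B(3) by blast
  with L(2)[of w] show False by simp
qed

lemma linear_map_eq_lincomb:
  assumes "linear_map fscale s L"
  shows "L u = lincomb s u (\<lambda>x. L (basis x))"
proof -
  have "L u = L (lincomb fscale u basis)" by (simp add: lincomb_basis_self)
  then show ?thesis unfolding lincomb_def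
    by (simp add: linear_map_sum[OF assms] linear_map_scale[OF assms])
qed

text \<open>Converse to \<open>lincomb_tensor_null\<close>: a functional on formal combinations that
  kills the generators of \<open>tensor_null\<close> amounts to a bilinear form, so scalar forms
  detect membership in \<open>tensor_null\<close>.\<close>

lemma tensor_class_eqI:
  fixes s :: "'k::field \<Rightarrow> 'a::ab_group_add \<Rightarrow> 'a" and t :: "'k \<Rightarrow> 'b::ab_group_add \<Rightarrow> 'b"
  assumes st: "vector_space s" "vector_space t"
    and eq: "\<And>F :: 'a \<Rightarrow> 'b \<Rightarrow> 'k. bilinear_map s t (*) F \<Longrightarrow>
      lincomb (*) u (\<lambda>(x, y). F x y) = lincomb (*) v (\<lambda>(x, y). F x y)"
  shows "tensor_class s t u = tensor_class s t v"
  unfolding tensor_class_eq_iff tensor_null_def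
proof (rule span_separation[OF vector_space_fscale])
  fix L :: "('a \<times> 'b \<Rightarrow>\<^sub>0 'k) \<Rightarrow> 'k"
  assume L: "linear_map fscale (*) L"
    and null: "\<And>x. x \<in> {basis (x + x', y) - basis (x, y) - basis (x', y) | x x' y. True}
      \<union> {basis (x, y + y') - basis (x, y) - basis (x, y') | x y y'. True}
      \<union> {basis (s c x, y) - fscale c (basis (x, y)) | c x y. True}
      \<union> {basis (x, t c y) - fscale c (basis (x, y)) | c x y. True} \<Longrightarrow> L x = 0"
  have Ls: "L (x - y) = L x - L y" "L (fscale c x) = c * L x" for x y c
    by (simp_all add: linear_map_diff[OF L] linear_map_scale[OF L])
  have z: "L (basis (x + x', y) - basis (x, y) - basis (x', y)) = 0"
    "L (basis (x, y + y') - basis (x, y) - basis (x, y')) = 0"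
    "L (basis (s c x, y) - fscale c (basis (x, y))) = 0"
    "L (basis (x, t c y) - fscale c (basis (x, y))) = 0" for x x' y y' c
    by (rule null; blast)+
  have b: "L (basis (x + x', y)) = L (basis (x, y)) + L (basis (x', y))"
    "L (basis (x, y + y')) = L (basis (x, y)) + L (basis (x, y'))"
    "L (basis (s c x, y)) = c * L (basis (x, y))" "L (basis (x, t c y)) = c * L (basis (x, y))"
    for x x' y y' c
    using z(1)[of x x' y] z(2)[of x y y'] z(3)[of c x y] z(4)[of x c y]
    by (simp_all add: Ls diff_eq_eq add.commute)
  have "bilinear_map s t (*) (\<lambda>x y. L (basis (x, y)))"
    by (intro bilinear_mapI linear_mapI st vector_space_mult b)
  moreover have "(\<lambda>(x, y). L (basis (x, y))) = (\<lambda>x. L (basis x))" by auto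
  ultimately show "L (u - v) = 0"
    using eq[of "\<lambda>x y. L (basis (x, y))"]
    by (simp add: Ls linear_map_eq_lincomb[OF L, of u] linear_map_eq_lincomb[OF L, of v])
qed

definition trilinear_form ::
  "('k::field \<Rightarrow> 'a::ab_group_add \<Rightarrow> 'a) \<Rightarrow> ('a \<Rightarrow> 'a \<Rightarrow> 'a \<Rightarrow> 'k) \<Rightarrow> bool" where
  "trilinear_form s F \<longleftrightarrow> (\<forall>y z. linear_map s (*) (\<lambda>x. F x y z)) \<and>
     (\<forall>x z. linear_map s (*) (\<lambda>y. F x y z)) \<and> (\<forall>x y. linear_map s (*) (\<lambda>z. F x y z))"

text \<open>The same separation argument in three variables; it reduces coassociativity to scalar
  identities.\<close>

lemma tensor3_class_eqI:
  fixes s :: "'k::field \<Rightarrow> 'a::ab_group_add \<Rightarrow> 'a"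
  assumes st: "vector_space s"
    and eq: "\<And>F. trilinear_form s F \<Longrightarrow>
      lincomb (*) u (\<lambda>(x, y, z). F x y z) = lincomb (*) v (\<lambda>(x, y, z). F x y z)"
  shows "tensor3_class s u = tensor3_class s v"
proof -
  interpret T: vector_space "fscale :: 'k \<Rightarrow> ('a \<times> 'a \<times> 'a \<Rightarrow>\<^sub>0 'k) \<Rightarrow> _" by (rule vector_space_fscale)
  have N: "T.subspace (tensor3_null s)" unfolding tensor3_null_def by (rule T.subspace_span)
  have "u - v \<in> tensor3_null s"
    unfolding tensor3_null_def
  proof (rule span_separation[OF vector_space_fscale])
    fix L :: "('a \<times> 'a \<times> 'a \<Rightarrow>\<^sub>0 'k) \<Rightarrow> 'k"
    let ?N = "{basis (x + x', y, z) - basis (x, y, z) - basis (x', y, z) | x x' y z. True}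
      \<union> {basis (x, y + y', z) - basis (x, y, z) - basis (x, y', z) | x y y' z. True}
      \<union> {basis (x, y, z + z') - basis (x, y, z) - basis (x, y, z') | x y z z'. True}
      \<union> {basis (s c x, y, z) - fscale c (basis (x, y, z)) | c x y z. True}
      \<union> {basis (x, s c y, z) - fscale c (basis (x, y, z)) | c x y z. True}
      \<union> {basis (x, y, s c z) - fscale c (basis (x, y, z)) | c x y z. True}"
    assume L: "linear_map fscale (*) L" and null: "\<And>x. x \<in> ?N \<Longrightarrow> L x = 0"
    have Ls: "L (x - y) = L x - L y" "L (fscale c x) = c * L x" for x y c
      by (simp_all add: linear_map_diff[OF L] linear_map_scale[OF L])
    have n: "L (basis (x + x', y, z) - basis (x, y, z) - basis (x', y, z)) = 0"
      "L (basis (x, y + y', z) - basis (x, y, z) - basis (x, y', z)) = 0"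
      "L (basis (x, y, z + z') - basis (x, y, z) - basis (x, y, z')) = 0"
      "L (basis (s c x, y, z) - fscale c (basis (x, y, z))) = 0"
      "L (basis (x, s c y, z) - fscale c (basis (x, y, z))) = 0"
      "L (basis (x, y, s c z) - fscale c (basis (x, y, z))) = 0" for x x' y y' z z' c
      by (rule null, unfold Un_iff mem_Collect_eq, metis)+
    have b: "L (basis (x + x', y, z)) = L (basis (x, y, z)) + L (basis (x', y, z))"
      "L (basis (x, y + y', z)) = L (basis (x, y, z)) + L (basis (x, y', z))"
      "L (basis (x, y, z + z')) = L (basis (x, y, z)) + L (basis (x, y, z'))"
      "L (basis (s c x, y, z)) = c * L (basis (x, y, z))"
      "L (basis (x, s c y, z)) = c * L (basis (x, y, z))"
      "L (basis (x, y, s c z)) = c * L (basis (x, y, z))"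
      for x x' y y' z z' c
      using n(1)[of x x' y z] n(2)[of x y y' z] n(3)[of x y z z']
        n(4)[of c x y z] n(5)[of x c y z] n(6)[of x y c z]
      by (simp_all add: Ls diff_eq_eq add.commute)
    have "trilinear_form s (\<lambda>x y z. L (basis (x, y, z)))"
      unfolding trilinear_form_def by (intro conjI allI linear_mapI st vector_space_mult b)
    moreover have "(\<lambda>(x, y, z). L (basis (x, y, z))) = (\<lambda>x. L (basis x))" by auto
  ultimately show "L (u - v) = 0"
      using eq[of "\<lambda>x y z. L (basis (x, y, z))"]
      by (simp add: Ls linear_map_eq_lincomb[OF L, of u] linear_map_eq_lincomb[OF L, of v])
  qed
  then have "w - u \<in> tensor3_null s \<longleftrightarrow> w - v \<in> tensor3_null s" for w
    using T.subspace_add[OF N, of "w - u" "u - v"] T.subspace_diff[OF N, of "w - v" "u - v"] by auto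
  then show ?thesis unfolding tensor3_class_def by blast
qed

text \<open>The direction opposite to \<open>tensor3_class_eqI\<close>, with values in any space: it
  turns the coset equation \<open>coassoc\<close> into the reassociation of Sweedler sums.\<close>

lemma lincomb_tensor3_null:
  fixes s :: "'k::field \<Rightarrow> 'a::ab_group_add \<Rightarrow> 'a"
  assumes r: "vector_space r"
    and F: "\<And>y z. linear_map s r (\<lambda>x. F x y z)" "\<And>x z. linear_map s r (\<lambda>y. F x y z)"
      "\<And>x y. linear_map s r (\<lambda>z. F x y z)"
    and eq: "tensor3_class s u = tensor3_class s v"
  shows "lincomb r u (\<lambda>(x, y, z). F x y z) = lincomb r v (\<lambda>(x, y, z). F x y z)"
proof -
  interpret T: vector_space "fscale :: 'k \<Rightarrow> ('a \<times> 'a \<times> 'a \<Rightarrow>\<^sub>0 'k) \<Rightarrow> _" by (rule vector_space_fscale)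
  interpret R: vector_space r by (rule r)
  let ?L = "\<lambda>u. lincomb r u (\<lambda>(x, y, z). F x y z)"
  have L: "linear_map fscale r ?L" by (rule linear_lincomb[OF r])
  have "u \<in> tensor3_class s u"
    unfolding tensor3_class_def tensor3_null_def by (simp add: T.span_zero)
  then have "u - v \<in> tensor3_null s" by (simp add: eq) (simp add: tensor3_class_def)
  then have "?L (u - v) = 0"
    unfolding tensor3_null_def
  proof (rule T.span_induct)
    show "T.subspace {u. ?L u = 0}"
      by (auto simp: T.subspace_def linear_map_add[OF L] linear_map_0[OF L] linear_map_scale[OF L]
          R.scale_zero_right)
  qed (auto simp: linear_map_diff[OF L] linear_map_scale[OF L] lincomb_basis[OF r]
      linear_map_add[OF F(1)] linear_map_add[OF F(2)] linear_map_add[OF F(3)]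
      linear_map_scale[OF F(1)] linear_map_scale[OF F(2)] linear_map_scale[OF F(3)])
  then show ?thesis by (simp add: linear_map_diff[OF L])
qed

section \<open>Sweedler calculus\<close>

text \<open>Holds for arbitrary \<open>F\<close>, because a Sweedler sum is one finite linear
  combination over a fixed representative and f is applied term by term.\<close>

lemma sweedler_linear_map:
  assumes "linear_map t t' f"
  shows "f (sweedler H t a F) = sweedler H t' a (\<lambda>x y. f (F x y))"
  unfolding sweedler_def lincomb_def
  by (simp add: linear_map_sum[OF assms] linear_map_scale[OF assms] case_prod_beta)

lemma sweedler_mult_left: "c * sweedler H (*) a F = sweedler H (*) a (\<lambda>x y. c * F x y)"
  by (rule sweedler_linear_map) (intro multilinear)

lemma sweedler_mult_right: "sweedler H (*) a F * c = sweedler H (*) a (\<lambda>x y. F x y * c)"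
  by (rule sweedler_linear_map[where f = "\<lambda>x. x * c"]) (intro multilinear)

lemma sweedler_swap:
  assumes "vector_space t"
  shows "sweedler H t a (\<lambda>x y. sweedler H' t b (\<lambda>x' y'. F x y x' y')) =
    sweedler H' t b (\<lambda>x' y'. sweedler H t a (\<lambda>x y. F x y x' y'))"
proof -
  interpret vector_space t by fact
  show ?thesis
    unfolding sweedler_def lincomb_def case_prod_beta scale_sum_right
    by (subst sum.swap) (simp add: mult.commute)
qed

text \<open>The variable sits in the summand and the coproduct is fixed;
  \<open>linear_map_sweedler\<close> treats a variable inside the coproduct.\<close>

lemma linear_map_sweedler_fun [multilinear]:
  assumes "vector_space s" "vector_space t" "\<And>y z. linear_map s t (\<lambda>x. F x y z)"
  shows "linear_map s t (\<lambda>x. sweedler H t a (F x))"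
  unfolding sweedler_def lincomb_def case_prod_beta
  using assms by (intro multilinear linear_map_scale_scalar)

text \<open>Allows a coproduct to be evaluated on any known representative u instead of the chosen
  one.\<close>

lemma sweedler_class:
  assumes "comult H a = hclass H u" "vector_space t" "bilinear_map (hscale H) (hscale H) t F"
  shows "sweedler H t a F = lincomb t u (\<lambda>(x, y). F x y)"
  unfolding sweedler_def using assms by (simp add: lincomb_tensor_rep)

lemma comult_eq_classI:
  fixes H :: "('k::field, 'a::ab_group_add) hopf"
  assumes s: "vector_space (hscale H)"
    and T: "comult H a \<in> tensor_space (hscale H) (hscale H)"
    and eq: "\<And>F. bilinear_map (hscale H) (hscale H) (*) F \<Longrightarrow>
      sweedler H (*) a F = lincomb (*) u (\<lambda>(x, y). F x y)"
  shows "comult H a = hclass H u"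
proof -
  obtain v where v: "comult H a = hclass H v" using T by (auto simp: tensor_space_def)
  have "hclass H v = hclass H u"
    using eq by (intro tensor_class_eqI s) (simp add: sweedler_class[OF v vector_space_mult])
  with v show ?thesis by simp
qed

lemma lincomb_sweedler:
  assumes "vector_space t"
  shows "lincomb t (sweedler H fscale a G) F = sweedler H t a (\<lambda>x y. lincomb t (G x y) F)"
  by (rule sweedler_linear_map) (rule linear_lincomb[OF assms])

lemma comult_homI:
  assumes "vector_space (hscale H')" "comult H' b \<in> tensor_space (hscale H') (hscale H')"
    and "\<And>F. bilinear_map (hscale H') (hscale H') (*) F \<Longrightarrow>
      sweedler H' (*) b F = sweedler H (*) a (\<lambda>x y. F (f x) (f y))"
  shows "comult H' b = hclass H' (sweedler H fscale a (\<lambda>x y. basis (f x, f y)))"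
  using assms by (intro comult_eq_classI)
    (simp_all add: lincomb_sweedler[OF vector_space_mult] lincomb_basis[OF vector_space_mult])

section \<open>Hopf algebra axioms as rules for Sweedler sums\<close>

context hopf_algebra
begin

lemmas [multilinear] = vector_space

sublocale vs: vector_space "hscale H" by (rule vector_space)

lemma linear_map_hmult [multilinear]:
  "linear_map r (hscale H) f \<Longrightarrow> linear_map r (hscale H) (\<lambda>x. hmult H (f x) b)"
  "linear_map r (hscale H) f \<Longrightarrow> linear_map r (hscale H) (\<lambda>x. hmult H a (f x))"
  by (rule bilinear_mapD[OF mult_bilinear]; assumption)+

lemma linear_map_counit [multilinear]:
  "linear_map r (hscale H) f \<Longrightarrow> linear_map r (*) (\<lambda>x. counit H (f x))"
  by (rule linear_map_compose[OF _ counit_linear])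

lemma linear_map_antipode [multilinear]:
  "linear_map r (hscale H) f \<Longrightarrow> linear_map r (hscale H) (\<lambda>x. antipode H (f x))"
  by (rule linear_map_compose[OF _ antipode_linear])

text \<open>The representative changes with the argument of the coproduct, so bilinearity of
  \<open>F\<close> is what lets \<open>comult_add\<close> and \<open>comult_scale\<close> be read
  through \<open>sweedler_class\<close>.\<close>

lemma linear_map_sweedler [multilinear]:
  assumes "linear_map r (hscale H) f" "vector_space t"
    "\<And>y. linear_map (hscale H) t (\<lambda>x. F x y)" "\<And>x. linear_map (hscale H) t (\<lambda>y. F x y)"
  shows "linear_map r t (\<lambda>x. sweedler H t (f x) F)"
proof (rule linear_map_compose[OF assms(1)])
  have F: "bilinear_map (hscale H) (hscale H) t F"
    using assms by (intro bilinear_mapI)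
  have L: "linear_map fscale t (\<lambda>u. lincomb t u (\<lambda>(x, y). F x y))"
    by (rule linear_lincomb[OF assms(2)])
  show "linear_map (hscale H) t (\<lambda>x. sweedler H t x F)"
    by (intro linear_mapI vector_space assms(2))
      (simp_all add: sweedler_class[OF comult_add assms(2) F] sweedler_class[OF comult_scale assms(2) F]
        linear_map_add[OF L] linear_map_scale[OF L], simp_all add: sweedler_def)
qed

lemma sweedler_coassoc:
  assumes t: "vector_space t"
    and F: "\<And>y z. linear_map (hscale H) t (\<lambda>x. F x y z)" "\<And>x z. linear_map (hscale H) t (\<lambda>y. F x y z)"
      "\<And>x y. linear_map (hscale H) t (\<lambda>z. F x y z)"
  shows "sweedler H t a (\<lambda>x z. sweedler H t x (\<lambda>x y. F x y z)) =
    sweedler H t a (\<lambda>x y. sweedler H t y (\<lambda>y z. F x y z))"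
  using lincomb_tensor3_null[OF t F coassoc[of a]]
  by (simp add: lincomb_sweedler[OF t] lincomb_basis[OF t])

lemma sweedler_mult:
  assumes t: "vector_space t"
    and F: "\<And>y. linear_map (hscale H) t (\<lambda>x. F x y)" "\<And>x. linear_map (hscale H) t (\<lambda>y. F x y)"
  shows "sweedler H t (hmult H a b) F =
    sweedler H t a (\<lambda>x y. sweedler H t b (\<lambda>x' y'. F (hmult H x x') (hmult H y y')))"
  using sweedler_class[OF comult_mult t bilinear_mapI, OF F(2,1)]
  by (simp add: lincomb_sweedler[OF t] lincomb_basis[OF t])

lemma sweedler_one:
  assumes t: "vector_space t"
    and F: "\<And>y. linear_map (hscale H) t (\<lambda>x. F x y)" "\<And>x. linear_map (hscale H) t (\<lambda>y. F x y)"
  shows "sweedler H t (hone H) F = F (hone H) (hone H)"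
  using sweedler_class[OF comult_one t bilinear_mapI, OF F(2,1)]
  by (simp add: lincomb_basis[OF t])

lemma sweedler_scale_left:
  "hscale H c (sweedler H' (hscale H) a F) = sweedler H' (hscale H) a (\<lambda>x y. hscale H c (F x y))"
  by (rule sweedler_linear_map) (intro multilinear)

lemma sweedler_hmult_left:
  "hmult H b (sweedler H' (hscale H) a F) = sweedler H' (hscale H) a (\<lambda>x y. hmult H b (F x y))"
  by (rule sweedler_linear_map) (intro multilinear)

lemma sweedler_hmult_right:
  "hmult H (sweedler H' (hscale H) a F) b = sweedler H' (hscale H) a (\<lambda>x y. hmult H (F x y) b)"
  by (rule sweedler_linear_map[where f = "\<lambda>x. hmult H x b"]) (intro multilinear)

lemma hmult_scale [simp]:
  "hmult H (hscale H c a) b = hscale H c (hmult H a b)"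
  "hmult H a (hscale H c b) = hscale H c (hmult H a b)"
  using linear_map_scale[OF linear_map_hmult(1)[OF linear_map_ident[OF vector_space]]]
    linear_map_scale[OF linear_map_hmult(2)[OF linear_map_ident[OF vector_space]]] by auto

lemma hmult_zero [simp]: "hmult H 0 b = 0" "hmult H a 0 = 0"
  using linear_map_0[OF linear_map_hmult(1)[OF linear_map_ident[OF vector_space]]]
    linear_map_0[OF linear_map_hmult(2)[OF linear_map_ident[OF vector_space]]] by auto

lemma sweedler_zero:
  assumes t: "vector_space t"
    and F: "\<And>y. linear_map (hscale H) t (\<lambda>x. F x y)" "\<And>x. linear_map (hscale H) t (\<lambda>y. F x y)"
  shows "sweedler H t 0 F = 0"
  by (rule linear_map_0[of "hscale H" t]) (intro multilinear t F)+

lemma counit_scale [simp]: "counit H (hscale H c a) = c * counit H a"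
  by (rule linear_map_scale[OF counit_linear])

lemma sweedler_counit_left:
  assumes f: "linear_map (hscale H) t f"
  shows "sweedler H t a (\<lambda>x y. t (counit H x) (f y)) = f a"
  using arg_cong[OF counit_left[of a], of f]
  by (simp add: sweedler_linear_map[OF f] linear_map_scale[OF f])

lemma sweedler_counit_right:
  assumes f: "linear_map (hscale H) t f"
  shows "sweedler H t a (\<lambda>x y. t (counit H y) (f x)) = f a"
  using arg_cong[OF counit_right[of a], of f]
  by (simp add: sweedler_linear_map[OF f] linear_map_scale[OF f])

text \<open>The convolution computation T = T * (id * S) = (T * id) * S = S, where S is the given
  antipode. It takes the left antipode law from T and the right one from S.\<close>

lemma left_antipode_unique:
  assumes T: "linear_map (hscale H) (hscale H) T"
    and left: "\<And>a. sweedler H (hscale H) a (\<lambda>x y. hmult H (T x) y) = hscale H (counit H a) (hone H)"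
  shows "T = antipode H"
proof
  fix a
  note [multilinear] = linear_map_compose[OF _ T]
  have "T a = sweedler H (hscale H) a (\<lambda>x y. hmult H (T x) (hscale H (counit H y) (hone H)))"
    by (simp add: mult_one_right sweedler_counit_right[OF T])
  also have "\<dots> = sweedler H (hscale H) a (\<lambda>x y. sweedler H (hscale H) y
      (\<lambda>y z. hmult H (T x) (hmult H y (antipode H z))))"
    unfolding antipode_right[symmetric] sweedler_hmult_left ..
  also have "\<dots> = sweedler H (hscale H) a (\<lambda>x z. sweedler H (hscale H) x
      (\<lambda>x y. hmult H (T x) (hmult H y (antipode H z))))"
    by (rule sweedler_coassoc[symmetric]) (intro multilinear)+
  also have "\<dots> = sweedler H (hscale H) a (\<lambda>x z. hmult H (hscale H (counit H x) (hone H)) (antipode H z))"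
    unfolding mult_assoc[symmetric] sweedler_hmult_right[symmetric] left ..
  also have "\<dots> = antipode H a"
    by (simp add: mult_one_left sweedler_counit_left[OF antipode_linear])
  finally show "T a = antipode H a" .
qed

end

text \<open>All axioms that are equations between cosets are replaced by their tests against scalar
  forms; the premise \<open>lin\<close> stands for additivity and homogeneity of the
  coproduct.\<close>

lemma hopf_algebraI:
  fixes H :: "('k::field, 'a::ab_group_add) hopf"
  assumes s: "vector_space (hscale H)"
    and "bilinear_map (hscale H) (hscale H) (hscale H) (hmult H)"
    and "\<And>a b c. hmult H (hmult H a b) c = hmult H a (hmult H b c)"
    and "\<And>a. hmult H (hone H) a = a" "\<And>a. hmult H a (hone H) = a"
    and T: "\<And>a. comult H a \<in> tensor_space (hscale H) (hscale H)"
    and lin: "\<And>F. bilinear_map (hscale H) (hscale H) (*) F \<Longrightarrow>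
      linear_map (hscale H) (*) (\<lambda>a. sweedler H (*) a F)"
    and coassoc: "\<And>F a. trilinear_form (hscale H) F \<Longrightarrow>
      sweedler H (*) a (\<lambda>x z. sweedler H (*) x (\<lambda>x y. F x y z)) =
      sweedler H (*) a (\<lambda>x y. sweedler H (*) y (\<lambda>y z. F x y z))"
    and "Vector_Spaces.linear (hscale H) (*) (counit H)"
    and "\<And>a. sweedler H (hscale H) a (\<lambda>x y. hscale H (counit H x) y) = a"
    and "\<And>a. sweedler H (hscale H) a (\<lambda>x y. hscale H (counit H y) x) = a"
    and mult: "\<And>F a b. bilinear_map (hscale H) (hscale H) (*) F \<Longrightarrow> sweedler H (*) (hmult H a b) F =
      sweedler H (*) a (\<lambda>x y. sweedler H (*) b (\<lambda>x' y'. F (hmult H x x') (hmult H y y')))"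
    and one: "\<And>F. bilinear_map (hscale H) (hscale H) (*) F \<Longrightarrow>
      sweedler H (*) (hone H) F = F (hone H) (hone H)"
    and "\<And>a b. counit H (hmult H a b) = counit H a * counit H b" "counit H (hone H) = 1"
    and "Vector_Spaces.linear (hscale H) (hscale H) (antipode H)"
    and "\<And>a. sweedler H (hscale H) a (\<lambda>x y. hmult H (antipode H x) y) = hscale H (counit H a) (hone H)"
    and "\<And>a. sweedler H (hscale H) a (\<lambda>x y. hmult H x (antipode H y)) = hscale H (counit H a) (hone H)"
  shows "hopf_algebra H"
proof -
  note lc = linear_lincomb[OF vector_space_mult]
  note sw = lincomb_sweedler[OF vector_space_mult] lincomb_basis[OF vector_space_mult]
  show ?thesis
  proof (rule hopf_algebra.intro)
    fix a b
    show "comult H (a + b) = hclass H (tensor_rep (comult H a) + tensor_rep (comult H b))"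
      by (intro comult_eq_classI s T)
        (simp add: linear_map_add[OF lc] linear_map_add[OF lin], simp add: sweedler_def)
    show "comult H (hmult H a b) = hclass H (sweedler H fscale a (\<lambda>x y. sweedler H fscale b
        (\<lambda>x' y'. basis (hmult H x x', hmult H y y'))))"
      by (intro comult_eq_classI s T) (simp add: mult sw)
  next
    fix k a
    show "comult H (hscale H k a) = hclass H (fscale k (tensor_rep (comult H a)))"
      by (intro comult_eq_classI s T)
        (simp add: linear_map_scale[OF lc] linear_map_scale[OF lin], simp add: sweedler_def)
  next
    fix a
    show "tensor3_class (hscale H)
         (sweedler H fscale a (\<lambda>x z. sweedler H fscale x (\<lambda>x y. basis (x, y, z)))) =
       tensor3_class (hscale H)
         (sweedler H fscale a (\<lambda>x y. sweedler H fscale y (\<lambda>y z. basis (x, y, z))))"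
      by (intro tensor3_class_eqI s) (simp add: sw coassoc)
  next
    show "comult H (hone H) = hclass H (basis (hone H, hone H))"
      by (intro comult_eq_classI s T) (simp add: one sw)
  qed (fact assms)+
qed

section \<open>Hopf algebra morphisms and their images\<close>

lemma hopf_homD:
  assumes "hopf_hom H H' f"
  shows "linear_map (hscale H) (hscale H') f" "f (hmult H a b) = hmult H' (f a) (f b)"
    "f (hone H) = hone H'" "counit H' (f a) = counit H a" "f (antipode H a) = antipode H' (f a)"
    "comult H' (f a) = hclass H' (sweedler H fscale a (\<lambda>x y. basis (f x, f y)))"
  using assms by (auto simp: hopf_hom_def)

lemma sweedler_hopf_hom:
  assumes f: "hopf_hom H H' f" and t: "vector_space t"
    and F: "\<And>y. linear_map (hscale H') t (\<lambda>x. F x y)" "\<And>x. linear_map (hscale H') t (\<lambda>y. F x y)"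
  shows "sweedler H' t (f a) F = sweedler H t a (\<lambda>x y. F (f x) (f y))"
  using sweedler_class[OF hopf_homD(6)[OF f] t bilinear_mapI, OF F(2,1)]
  by (simp add: lincomb_sweedler[OF t] lincomb_basis[OF t])

text \<open>Applied to \<open>grade\<close>, whose range is the graded twisting, this spares
  checking closure of the graded twisting on its spanning set.\<close>

lemma hopf_subalgebra_range:
  assumes H: "hopf_algebra H" and f: "hopf_hom H H' f"
  shows "hopf_subalgebra H' (range f)"
proof -
  interpret hopf_algebra H by fact
  interpret L: Vector_Spaces.linear "hscale H" "hscale H'" f
    by (rule hopf_homD(1)[OF f])
  \<comment> \<open>The combination is a sum of multiples of basis vectors at points (f x, f y), so
    its support stays in the square of the range.\<close>
  have keys: "Poly_Mapping.keys (sweedler H fscale a (\<lambda>x y. basis (f x, f y))) \<subseteq> range f \<times> range f" for a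
  proof -
    have "Poly_Mapping.lookup (sweedler H fscale a (\<lambda>x y. basis (f x, f y))) z = 0"
      if "z \<notin> range f \<times> range f" for z
      unfolding sweedler_def lincomb_def lookup_sum case_prod_beta using that
      by (intro sum.neutral) (auto simp: lookup_pm_scale lookup_single when_def)
    then show ?thesis by (meson in_keys_iff subsetI)
  qed
  show ?thesis
    unfolding hopf_subalgebra_def
  proof (intro conjI ballI)
    show "module.subspace (hscale H') (range f)"
      using L.subspace_image[OF vs.subspace_UNIV] .
    show "hone H' \<in> range f" by (metis hopf_homD(3)[OF f] rangeI)
    fix a b assume "a \<in> range f" "b \<in> range f"
    then show "hmult H' a b \<in> range f" by (auto simp flip: hopf_homD(2)[OF f])
  next
    fix a assume "a \<in> range f"
    then obtain c where a: "a = f c" by auto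
    show "\<exists>u. Poly_Mapping.keys u \<subseteq> range f \<times> range f \<and> comult H' a = hclass H' u"
      unfolding a hopf_homD(6)[OF f] using keys[of c] by blast
    show "antipode H' a \<in> range f" unfolding a by (auto simp flip: hopf_homD(5)[OF f])
  qed
qed

section \<open>Crossed products\<close>

text \<open>The common shape of all crossed product operations: the map on finitely supported
  families that a family of maps \<open>F g\<close> on the summands induces. It is meant for
  \<open>F g 0 = 0\<close>, where enlarging the index set changes nothing.\<close>

definition graded_sum :: "('g \<Rightarrow>\<^sub>0 'a::zero) \<Rightarrow> ('g \<Rightarrow> 'a \<Rightarrow> 'v) \<Rightarrow> 'v::comm_monoid_add" where
  "graded_sum u F = (\<Sum>g\<in>Poly_Mapping.keys u. F g (Poly_Mapping.lookup u g))"

lemma graded_sum_superset: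
  assumes "finite X" "Poly_Mapping.keys u \<subseteq> X" "\<And>g. F g 0 = 0"
  shows "graded_sum u F = (\<Sum>g\<in>X. F g (Poly_Mapping.lookup u g))"
  unfolding graded_sum_def using assms by (intro sum.mono_neutral_left) (auto simp: in_keys_iff)

lemma graded_sum_single: "F g 0 = 0 \<Longrightarrow> graded_sum (Poly_Mapping.single g x) F = F g x"
  by (simp add: graded_sum_def)

lemma graded_sum_single_self: "graded_sum u Poly_Mapping.single = u"
  unfolding graded_sum_def
  by (rule poly_mapping_eqI) (simp add: lookup_sum lookup_single when_def sum.delta in_keys_iff)

lemmas [multilinear] = vector_space_pm_scale

lemma linear_map_graded_sum:
  fixes F :: "'g \<Rightarrow> 'a::ab_group_add \<Rightarrow> 'v::ab_group_add"
  assumes f: "linear_map r (pm_scale s) f" and s: "vector_space s"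
    and t: "vector_space t" and F: "\<And>g. linear_map s t (F g)"
  shows "linear_map r t (\<lambda>x. graded_sum (f x) F)"
proof (rule linear_map_compose[OF f], rule linear_mapI)
  interpret S: vector_space s by fact
  interpret T: vector_space t by fact
  note F0 = linear_map_0[OF F]
  show "graded_sum (x + y) F = graded_sum x F + graded_sum y F" for x y :: "'g \<Rightarrow>\<^sub>0 'a"
    using keys_add[of x y]
    by (simp add: graded_sum_superset[of "Poly_Mapping.keys x \<union> Poly_Mapping.keys y"] F0 lookup_add
        linear_map_add[OF F] sum.distrib)
  show "graded_sum (pm_scale s c x) F = t c (graded_sum x F)" for c and x :: "'g \<Rightarrow>\<^sub>0 'a"
  proof -
    have "Poly_Mapping.keys (pm_scale s c x) \<subseteq> Poly_Mapping.keys x"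
      by (auto simp: in_keys_iff lookup_pm_scale)
    then show ?thesis
      by (simp add: graded_sum_superset[of "Poly_Mapping.keys x"] F0 lookup_pm_scale
          linear_map_scale[OF F] T.scale_sum_right)
  qed
qed (intro multilinear s t)+

lemma linear_map_graded_sum_fun [multilinear]:
  assumes "vector_space r" "vector_space t" "\<And>g y. linear_map r t (\<lambda>x. F x g y)"
  shows "linear_map r t (\<lambda>x. graded_sum u (F x))"
  unfolding graded_sum_def using assms by (intro multilinear)

lemma linear_map_single [multilinear]:
  assumes f: "linear_map r s f"
  shows "linear_map r (pm_scale s) (\<lambda>x. Poly_Mapping.single g (f x))"
proof -
  interpret vector_space s using f by (simp add: linear_map_iff)
  show ?thesis using f unfolding linear_map_iff
    by (auto intro!: vector_space_pm_scale poly_mapping_eqI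
        simp: single_add lookup_pm_scale lookup_single when_def)
qed

text \<open>The elementary tensors a \<otimes> g span, so identities in the crossed product need
  checking only on them.\<close>

lemma linear_map_eq_on_singles:
  fixes f h :: "('g \<Rightarrow>\<^sub>0 'a::ab_group_add) \<Rightarrow> 'v::ab_group_add"
  assumes f: "linear_map (pm_scale s) t f" and h: "linear_map (pm_scale s) t h"
    and eq: "\<And>g a. f (Poly_Mapping.single g a) = h (Poly_Mapping.single g a)"
  shows "f u = h u"
  by (subst (1 2) graded_sum_single_self[of u, symmetric])
    (simp add: graded_sum_def linear_map_sum[OF f] linear_map_sum[OF h] eq)

text \<open>The data arrive in three layers: the crossed product is built from the action alone, the
  grading and the twisted structure need p as well, and \<phi> is added last.\<close>

locale hopf_action = hopf_algebra A for A :: "('k::field, 'a::ab_group_add) hopf" +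
  fixes \<alpha> :: "'g::group_add \<Rightarrow> 'a \<Rightarrow> 'a"
  assumes action_hopf_hom: "hopf_hom A A (\<alpha> g)"
    and action_0: "\<alpha> 0 a = a"
    and action_add: "\<alpha> (g + h) a = \<alpha> g (\<alpha> h a)"
begin

abbreviation S where "S \<equiv> hscale A"
abbreviation C where "C \<equiv> crossed_product A \<alpha>"
abbreviation sg where "sg \<equiv> Poly_Mapping.single"

lemmas [multilinear] = linear_map_graded_sum[where s = S]

lemma linear_map_action [multilinear]:
  "linear_map r S f \<Longrightarrow> linear_map r S (\<lambda>x. \<alpha> g (f x))"
  by (rule linear_map_compose[OF _ hopf_homD(1)[OF action_hopf_hom]])

lemmas action_simps = hopf_homD(2-5)[OF action_hopf_hom] action_0
  linear_map_0[OF hopf_homD(1)[OF action_hopf_hom]] linear_map_scale[OF hopf_homD(1)[OF action_hopf_hom]]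

lemma crossed_product_simps:
  "hscale C = pm_scale S"
  "hone C = sg 0 (hone A)"
  "hmult C u v = graded_sum u (\<lambda>g x. graded_sum v (\<lambda>h y. sg (g + h) (hmult A x (\<alpha> g y))))"
  "comult C u = hclass C (graded_sum u (\<lambda>g x. sweedler A fscale x (\<lambda>x y. basis (sg g x, sg g y))))"
  "counit C u = graded_sum u (\<lambda>g. counit A)"
  "antipode C u = graded_sum u (\<lambda>g x. sg (- g) (antipode A (\<alpha> (- g) x)))"
  by (simp_all add: crossed_product_def graded_sum_def)

lemma linear_map_crossed_mult [multilinear]:
  "linear_map r (pm_scale S) f \<Longrightarrow> linear_map r (pm_scale S) (\<lambda>x. hmult C (f x) b)"
  "linear_map r (pm_scale S) f \<Longrightarrow> linear_map r (pm_scale S) (\<lambda>x. hmult C a (f x))"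
proof -
  assume f: "linear_map r (pm_scale S) f"
  then have r: "vector_space r" by (simp add: linear_map_iff)
  show "linear_map r (pm_scale S) (\<lambda>x. hmult C (f x) b)" "linear_map r (pm_scale S) (\<lambda>x. hmult C a (f x))"
    unfolding crossed_product_simps by (intro multilinear f r)+
qed

lemma linear_map_crossed_counit [multilinear]:
  "linear_map r (pm_scale S) f \<Longrightarrow> linear_map r (*) (\<lambda>x. counit C (f x))"
  unfolding crossed_product_simps by (assumption | intro multilinear)+

lemma linear_map_crossed_antipode [multilinear]:
  "linear_map r (pm_scale S) f \<Longrightarrow> linear_map r (pm_scale S) (\<lambda>x. antipode C (f x))"
  unfolding crossed_product_simps by (assumption | intro multilinear)+

lemma crossed_single:
  "hmult C (sg g a) (sg h b) = sg (g + h) (hmult A a (\<alpha> g b))"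
  "counit C (sg g a) = counit A a"
  "antipode C (sg g a) = sg (- g) (antipode A (\<alpha> (- g) a))"
  by (simp_all add: crossed_product_simps graded_sum_single action_simps linear_map_0[OF counit_linear]
      linear_map_0[OF antipode_linear])

lemma sweedler_crossed:
  assumes t: "vector_space t" and F: "bilinear_map (pm_scale S) (pm_scale S) t F"
  shows "sweedler C t u F = graded_sum u (\<lambda>g a. sweedler A t a (\<lambda>x y. F (sg g x) (sg g y)))"
proof -
  have "sweedler C t u F = lincomb t
      (graded_sum u (\<lambda>g x. sweedler A fscale x (\<lambda>x y. basis (sg g x, sg g y)))) (\<lambda>(x, y). F x y)"
    using F by (intro sweedler_class crossed_product_simps(4) t) (simp add: crossed_product_simps)
  then show ?thesis
    by (simp add: graded_sum_def linear_map_sum[OF linear_lincomb[OF t]] lincomb_sweedler[OF t]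
        lincomb_basis[OF t])
qed

lemma linear_map_sweedler_crossed [multilinear]:
  assumes f: "linear_map r (pm_scale S) f" and t: "vector_space t"
    and F: "\<And>y. linear_map (pm_scale S) t (\<lambda>x. F x y)" "\<And>x. linear_map (pm_scale S) t (\<lambda>y. F x y)"
  shows "linear_map r t (\<lambda>x. sweedler C t (f x) F)"
proof -
  have b: "bilinear_map (pm_scale S) (pm_scale S) t F"
    using F by (intro bilinear_mapI)
  show ?thesis
    unfolding sweedler_crossed[OF t b]
    by (intro multilinear bilinear_mapD[OF b] f t)
qed

lemma sweedler_single:
  assumes t: "vector_space t"
    and F: "\<And>y. linear_map (pm_scale S) t (\<lambda>x. F x y)" "\<And>x. linear_map (pm_scale S) t (\<lambda>y. F x y)"
  shows "sweedler C t (sg g a) F = sweedler A t a (\<lambda>x y. F (sg g x) (sg g y))"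
proof -
  have b: "bilinear_map (pm_scale S) (pm_scale S) t F"
    using F by (intro bilinear_mapI)
  show ?thesis
    unfolding sweedler_crossed[OF t b]
    by (intro graded_sum_single sweedler_zero t multilinear bilinear_mapD[OF b])
qed

text \<open>Associativity on elementary tensors is extended to one argument at a time, from the last
  to the first, by linearity in that argument.\<close>

lemma crossed_mult_assoc: "hmult C (hmult C u v) w = hmult C u (hmult C v w)"
proof -
  have "hmult C (hmult C (sg g a) (sg h b)) (sg k c) = hmult C (sg g a) (hmult C (sg h b) (sg k c))"
    for g a h b k c
    by (simp add: crossed_single mult_assoc action_simps action_add add.assoc)
  note a1 = this
  have "hmult C (hmult C (sg g a) (sg h b)) w = hmult C (sg g a) (hmult C (sg h b) w)"
    for g a h b by (rule linear_map_eq_on_singles[of S "pm_scale S" _ _ w]; (intro multilinear)?) (rule a1)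
  note a2 = this
  have "hmult C (hmult C (sg g a) v) w = hmult C (sg g a) (hmult C v w)" for g a
    by (rule linear_map_eq_on_singles[of S "pm_scale S" _ _ v]; (intro multilinear)?) (rule a2)
  note a3 = this
  show ?thesis
    by (rule linear_map_eq_on_singles[of S "pm_scale S" _ _ u]; (intro multilinear)?) (rule a3)
qed

theorem hopf_algebra_crossed_product: "hopf_algebra C"
proof (rule hopf_algebraI, unfold crossed_product_simps(1))
  let ?P = "pm_scale S"
  show "vector_space ?P" by (intro multilinear)
  show "bilinear_map ?P ?P ?P (hmult C)"
    by (intro bilinear_mapI multilinear)
  show "hmult C (hmult C u v) w = hmult C u (hmult C v w)" for u v w by (rule crossed_mult_assoc)
  show "hmult C (hone C) u = u" for u
    by (rule linear_map_eq_on_singles[of S ?P _ _ u]; (intro multilinear)?)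
      (simp add: crossed_product_simps(2) crossed_single mult_one_left action_simps)
  show "hmult C u (hone C) = u" for u
    by (rule linear_map_eq_on_singles[of S ?P _ _ u]; (intro multilinear)?)
      (simp add: crossed_product_simps(2) crossed_single mult_one_right action_simps)
  show "comult C u \<in> tensor_space ?P ?P" for u
    by (simp add: crossed_product_simps tensor_space_def)
  show "linear_map ?P (*) (counit C)" by (intro multilinear)
  show "linear_map ?P ?P (antipode C)" by (intro multilinear)
  show "counit C (hone C) = 1"
    by (simp add: crossed_product_simps(2) crossed_single counit_one)
  show "counit C (hmult C u v) = counit C u * counit C v" for u v
  proof -
    have "counit C (hmult C (sg g a) (sg h b)) = counit C (sg g a) * counit C (sg h b)" for g h a b
      by (simp add: crossed_single counit_mult action_simps)
    note a1 = this
    have "counit C (hmult C (sg g a) v) = counit C (sg g a) * counit C v" for g a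
      by (rule linear_map_eq_on_singles[of S "(*)" _ _ v]; (intro multilinear)?) (rule a1)
    note a2 = this
    show ?thesis
      by (rule linear_map_eq_on_singles[of S "(*)" _ _ u]; (intro multilinear)?) (rule a2)
  qed
  show "sweedler C ?P u (\<lambda>x y. ?P (counit C x) y) = u" for u
  proof (rule linear_map_eq_on_singles[of S ?P _ _ u])
    show "sweedler C ?P (sg g a) (\<lambda>x y. ?P (counit C x) y) = sg g a" for g a
    proof -
      have "linear_map S ?P (sg g)" by (intro multilinear)
      from sweedler_counit_left[OF this, of a] show ?thesis
        by (subst sweedler_single; (intro multilinear)?) (simp add: crossed_single)
    qed
  qed (intro multilinear)+
  show "sweedler C ?P u (\<lambda>x y. ?P (counit C y) x) = u" for u
  proof (rule linear_map_eq_on_singles[of S ?P _ _ u])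
    show "sweedler C ?P (sg g a) (\<lambda>x y. ?P (counit C y) x) = sg g a" for g a
    proof -
      have "linear_map S ?P (sg g)" by (intro multilinear)
      from sweedler_counit_right[OF this, of a] show ?thesis
        by (subst sweedler_single; (intro multilinear)?) (simp add: crossed_single)
    qed
  qed (intro multilinear)+
  show "sweedler C ?P u (\<lambda>x y. hmult C (antipode C x) y) = ?P (counit C u) (hone C)" for u
  proof (rule linear_map_eq_on_singles[of S ?P _ _ u])
    fix g a
    \<comment> \<open>Multiplying S(\<alpha>_{-g}(x)) \<otimes> -g by y \<otimes> g applies
      \<alpha>_{-g} to y too, so \<alpha>_{-g} comes out as a common factor and the antipode law of
      A applies inside it.\<close>
    have "sweedler C ?P (sg g a) (\<lambda>x y. hmult C (antipode C x) y) =
        sweedler A ?P a (\<lambda>x y. sg 0 (\<alpha> (- g) (hmult A (antipode A x) y)))"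
      by (subst sweedler_single; (intro multilinear)?) (simp add: crossed_single action_simps)
    also have "\<dots> = sg 0 (\<alpha> (- g) (S (counit A a) (hone A)))"
      unfolding antipode_left[symmetric]
      by (rule sweedler_linear_map[symmetric]) (intro multilinear)
    also have "\<dots> = ?P (counit C (sg g a)) (hone C)"
      using linear_map_scale[OF linear_map_single[OF linear_map_ident[OF vector_space]]]
      by (simp add: crossed_single action_simps crossed_product_simps(2))
    finally show "sweedler C ?P (sg g a) (\<lambda>x y. hmult C (antipode C x) y) =
      ?P (counit C (sg g a)) (hone C)" .
  qed (intro multilinear)+
  show "sweedler C ?P u (\<lambda>x y. hmult C x (antipode C y)) = ?P (counit C u) (hone C)" for u
  proof (rule linear_map_eq_on_singles[of S ?P _ _ u])
    fix g a
    \<comment> \<open>On this side \<alpha>_g meets \<alpha>_{-g} on the second leg and they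
      cancel.\<close>
    have "sweedler C ?P (sg g a) (\<lambda>x y. hmult C x (antipode C y)) =
        sweedler A ?P a (\<lambda>x y. sg 0 (hmult A x (antipode A y)))"
      by (subst sweedler_single; (intro multilinear)?)
        (simp add: crossed_single action_simps flip: action_add)
    also have "\<dots> = sg 0 (S (counit A a) (hone A))"
      unfolding antipode_right[symmetric]
      by (rule sweedler_linear_map[symmetric]) (intro multilinear)
    also have "\<dots> = ?P (counit C (sg g a)) (hone C)"
      using linear_map_scale[OF linear_map_single[OF linear_map_ident[OF vector_space]]]
      by (simp add: crossed_single action_simps crossed_product_simps(2))
    finally show "sweedler C ?P (sg g a) (\<lambda>x y. hmult C x (antipode C y)) =
      ?P (counit C (sg g a)) (hone C)" .
  qed (intro multilinear)+
next
  fix F :: "('g \<Rightarrow>\<^sub>0 'a) \<Rightarrow> ('g \<Rightarrow>\<^sub>0 'a) \<Rightarrow> 'k"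
  assume "bilinear_map (pm_scale S) (pm_scale S) (*) F"
  note [multilinear] = bilinear_mapD[OF this]
  show "linear_map (pm_scale S) (*) (\<lambda>u. sweedler C (*) u F)" by (intro multilinear)
  show "sweedler C (*) (hone C) F = F (hone C) (hone C)"
    unfolding crossed_product_simps(2)
    by (subst sweedler_single; (intro multilinear)?) (subst sweedler_one; (intro multilinear)?; simp)
  show "sweedler C (*) (hmult C u v) F =
    sweedler C (*) u (\<lambda>x y. sweedler C (*) v (\<lambda>x' y'. F (hmult C x x') (hmult C y y')))" for u v
  proof -
    \<comment> \<open>The coproduct passes through \<alpha>_g because \<alpha>_g is a coalgebra
      map.\<close>
    have "sweedler C (*) (hmult C (sg g a) (sg h b)) F = sweedler C (*) (sg g a)
        (\<lambda>x y. sweedler C (*) (sg h b) (\<lambda>x' y'. F (hmult C x x') (hmult C y y')))" for g h a b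
      unfolding crossed_single
      by (subst sweedler_single, (intro multilinear)+,
          subst sweedler_mult, (intro multilinear)+,
          subst sweedler_hopf_hom[OF action_hopf_hom], (intro multilinear)+,
          subst sweedler_single, (intro multilinear)+,
          subst sweedler_single, (intro multilinear)+)
        (simp add: crossed_single)
    note a1 = this
    have "sweedler C (*) (hmult C (sg g a) v) F = sweedler C (*) (sg g a)
        (\<lambda>x y. sweedler C (*) v (\<lambda>x' y'. F (hmult C x x') (hmult C y y')))" for g a
      by (rule linear_map_eq_on_singles[of S "(*)" _ _ v]; (intro multilinear)?) (rule a1)
    note a2 = this
    show ?thesis
      by (rule linear_map_eq_on_singles[of S "(*)" _ _ u]; (intro multilinear)?) (rule a2)
  qed
next
  fix F :: "('g \<Rightarrow>\<^sub>0 'a) \<Rightarrow> ('g \<Rightarrow>\<^sub>0 'a) \<Rightarrow> ('g \<Rightarrow>\<^sub>0 'a) \<Rightarrow> 'k" and u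
  assume "trilinear_form (pm_scale S) F"
  then have F: "linear_map (pm_scale S) (*) (\<lambda>x. F x y z)" "linear_map (pm_scale S) (*) (\<lambda>y. F x y z)"
    "linear_map (pm_scale S) (*) (\<lambda>z. F x y z)" for x y z
    by (auto simp: trilinear_form_def)
  note [multilinear] = linear_map_compose[OF _ F(1)] linear_map_compose[OF _ F(2)]
    linear_map_compose[OF _ F(3)]
  show "sweedler C (*) u (\<lambda>x z. sweedler C (*) x (\<lambda>x y. F x y z)) =
      sweedler C (*) u (\<lambda>x y. sweedler C (*) y (\<lambda>y z. F x y z))"
  proof (rule linear_map_eq_on_singles[of S "(*)" _ _ u])
    fix g a
    show "sweedler C (*) (sg g a) (\<lambda>x z. sweedler C (*) x (\<lambda>x y. F x y z)) =
      sweedler C (*) (sg g a) (\<lambda>x y. sweedler C (*) y (\<lambda>y z. F x y z))"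
      by (subst (1 2) sweedler_single, (intro multilinear)+,
          subst (1 2) sweedler_single, (intro multilinear)+)
        (rule sweedler_coassoc; intro multilinear)
  qed (intro multilinear)+
qed

end

section \<open>The grading defined by a cocentral homomorphism\<close>

lemma linear_map_lookup:
  assumes "vector_space s"
  shows "linear_map (pm_scale s) s (\<lambda>u. Poly_Mapping.lookup u g)"
proof -
  interpret vector_space s by fact
  show ?thesis
    by (intro linear_mapI vector_space_pm_scale assms) (simp_all add: lookup_add lookup_pm_scale)
qed

text \<open>Each \<open>basis g\<close> is group-like, so only diagonal terms occur.\<close>

lemma sweedler_group_algebra:
  fixes F :: "('g::group_add \<Rightarrow>\<^sub>0 'k::field) \<Rightarrow> ('g \<Rightarrow>\<^sub>0 'k) \<Rightarrow> 'v::ab_group_add"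
  assumes t: "vector_space t" and F: "bilinear_map fscale fscale t F"
  shows "sweedler group_algebra t u F = lincomb t u (\<lambda>g. F (basis g) (basis g))"
proof -
  have "sweedler group_algebra t u F =
      lincomb t (lincomb fscale u (\<lambda>g. basis (basis g, basis g))) (\<lambda>(x, y). F x y)"
    using F t by (intro sweedler_class) (simp_all add: group_algebra_def)
  also have "\<dots> = lincomb t u (\<lambda>g. F (basis g) (basis g))"
    unfolding lincomb_def[of fscale]
    by (simp add: linear_map_sum[OF linear_lincomb[OF t]] linear_map_scale[OF linear_lincomb[OF t]]
        lincomb_basis[OF t]) (simp add: lincomb_def)
  finally show ?thesis .
qed

section \<open>Coordinates of p and projections onto the components\<close>

locale cocentral_action = hopf_action A \<alpha>
  for A :: "('k::field, 'a::ab_group_add) hopf" and \<alpha> :: "'g::group_add \<Rightarrow> 'a \<Rightarrow> 'a" +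
  fixes p :: "'a \<Rightarrow> ('g \<Rightarrow>\<^sub>0 'k)"
  assumes p_hom: "hopf_hom A group_algebra p" and p_cocentral: "cocentral A p"
    and p_action: "p (\<alpha> g a) = p a"
begin

lemma linear_map_p [multilinear]: "linear_map r S f \<Longrightarrow> linear_map r fscale (\<lambda>x. p (f x))"
  using linear_map_compose[OF _ hopf_homD(1)[OF p_hom]] by (simp add: group_algebra_def)

abbreviation pc :: "'g \<Rightarrow> 'a \<Rightarrow> 'k" where "pc g a \<equiv> Poly_Mapping.lookup (p a) g"

lemma linear_map_lookup_fscale [multilinear]:
  "linear_map r fscale f \<Longrightarrow> linear_map r (*) (\<lambda>x. Poly_Mapping.lookup (f x :: 'g \<Rightarrow>\<^sub>0 'k) g)"
  by (rule linear_map_compose[OF _ linear_map_lookup[OF vector_space_mult]])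

lemma linear_map_gtensor [multilinear]:
  "linear_map r S f \<Longrightarrow> linear_map r (pm_scale S) (\<lambda>x. gtensor A (f x) (w :: 'g \<Rightarrow>\<^sub>0 'k))"
  "linear_map r fscale h \<Longrightarrow> linear_map r (pm_scale S) (\<lambda>x. gtensor A v (h x :: 'g \<Rightarrow>\<^sub>0 'k))"
  by (rule bilinear_mapD[OF bilinear_gtensor[OF vector_space]]; assumption)+

text \<open>The coordinate functionals of the group algebra are orthogonal idempotents under
  convolution, since group elements are group-like; the coalgebra map p transports this to
  A.\<close>

lemma pc_comult: "sweedler A (*) a (\<lambda>x y. pc g x * pc h y) = (if g = h then pc g a else 0)"
proof -
  have b: "bilinear_map fscale fscale (*) (\<lambda>u v :: 'g \<Rightarrow>\<^sub>0 'k. Poly_Mapping.lookup u g * Poly_Mapping.lookup v h)"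
    by (intro bilinear_mapI multilinear)
  have "sweedler A (*) a (\<lambda>x y. pc g x * pc h y) =
      sweedler group_algebra (*) (p a) (\<lambda>u v. Poly_Mapping.lookup u g * Poly_Mapping.lookup v h)"
    by (subst sweedler_hopf_hom[OF p_hom])
      (simp_all add: group_algebra_def, (intro multilinear)+)
  also have "\<dots> = (\<Sum>k\<in>Poly_Mapping.keys (p a). if k = g \<and> g = h then pc g a else 0)"
    unfolding sweedler_group_algebra[OF vector_space_mult b] lincomb_def
    by (intro sum.cong) (auto simp: lookup_single when_def)
  also have "\<dots> = (if g = h then pc g a else 0)"
    by (cases "g = h") (auto simp: in_keys_iff)
  finally show ?thesis .
qed

lemma p_counit: "lincomb (*) (p a) (\<lambda>_. 1) = counit A a"
  using hopf_homD(4)[OF p_hom, of a] by (simp add: group_algebra_def)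

lemma p_one: "p (hone A) = basis 0"
  using hopf_homD(3)[OF p_hom] by (simp add: group_algebra_def)

lemma p_mult: "p (hmult A a b) = p a * p b"
  using hopf_homD(2)[OF p_hom] by (simp add: group_algebra_def)

lemma sweedler_cocentral:
  assumes t: "vector_space t" and F: "bilinear_map fscale S t F"
  shows "sweedler A t a (\<lambda>x y. F (p x) y) = sweedler A t a (\<lambda>x y. F (p y) x)"
proof -
  have "tensor_class fscale S (sweedler A fscale a (\<lambda>x y. basis (p x, y))) =
      tensor_class fscale S (sweedler A fscale a (\<lambda>x y. basis (p y, x)))"
    using p_cocentral by (simp add: cocentral_def)
  from lincomb_tensor_null[OF t F this[unfolded tensor_class_eq_iff]] show ?thesis
    by (simp add: linear_map_diff[OF linear_lincomb[OF t]] lincomb_sweedler[OF t] lincomb_basis[OF t])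
qed

text \<open>This is the map j: the right coaction of the group algebra on A obtained by applying p
  to the second leg.\<close>

definition grade :: "'a \<Rightarrow> ('g \<Rightarrow>\<^sub>0 'a)" where
  "grade a = sweedler A (pm_scale S) a (\<lambda>x y. gtensor A x (p y))"

text \<open>The convolution of the identity with the coordinate \<open>pc g\<close>, that is, the
  coefficient of \<open>grade a\<close> at g.\<close>

definition proj :: "'g \<Rightarrow> 'a \<Rightarrow> 'a" where
  "proj g a = sweedler A S a (\<lambda>x y. S (pc g y) x)"

abbreviation homog where "homog \<equiv> component A p"

lemma linear_map_grade [multilinear]: "linear_map r S f \<Longrightarrow> linear_map r (pm_scale S) (\<lambda>x. grade (f x))"
  unfolding grade_def by (assumption | intro multilinear)+

lemma linear_map_proj [multilinear]: "linear_map r S f \<Longrightarrow> linear_map r S (\<lambda>x. proj g (f x))"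
  unfolding proj_def by (assumption | intro multilinear)+

lemma lookup_grade: "Poly_Mapping.lookup (grade a) g = proj g a"
  unfolding grade_def proj_def sweedler_linear_map[OF linear_map_lookup[OF vector_space]]
  by (simp add: lookup_gtensor[OF vector_space])

text \<open>This is where cocentrality enters: the left and the right coaction defined by p give the
  same projections.\<close>

lemma proj_left: "proj g a = sweedler A S a (\<lambda>x y. S (pc g x) y)"
  unfolding proj_def
  by (rule sweedler_cocentral[symmetric, where F = "\<lambda>u. S (Poly_Mapping.lookup u g)"])
    (intro bilinear_mapI multilinear)+

text \<open>Coassociativity moves the projection to the second leg when \<open>pc g\<close> is
  evaluated on the right, and to the first leg when it is evaluated on the left as in
  \<open>proj_left\<close>.\<close>

lemma sweedler_proj:
  assumes t: "vector_space t"
    and F: "\<And>y. linear_map S t (\<lambda>x. F x y)" "\<And>x. linear_map S t (\<lambda>y. F x y)"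
  shows "sweedler A t (proj g a) F = sweedler A t a (\<lambda>x y. F x (proj g y))"
    and "sweedler A t (proj g a) F = sweedler A t a (\<lambda>x y. F (proj g x) y)"
proof -
  note [multilinear] = linear_map_compose[OF _ F(1)] linear_map_compose[OF _ F(2)] t
    linear_map_scale_vector[OF t] linear_map_scale_scalar[where t = t]
  have L: "linear_map S t (\<lambda>x. sweedler A t x F)" by (intro multilinear)
  have sc: "t c (sweedler A t x G) = sweedler A t x (\<lambda>x y. t c (G x y))" for c x G
    by (rule sweedler_linear_map) (intro multilinear)
  have "sweedler A t (proj g a) F = sweedler A t a (\<lambda>x z. sweedler A t x (\<lambda>x y. t (pc g z) (F x y)))"
    unfolding proj_def sweedler_linear_map[OF L] linear_map_scale[OF L] sc ..
  also have "\<dots> = sweedler A t a (\<lambda>x y. sweedler A t y (\<lambda>y z. t (pc g z) (F x y)))"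
    by (rule sweedler_coassoc; intro multilinear)
  also have "\<dots> = sweedler A t a (\<lambda>x y. F x (proj g y))"
    unfolding proj_def sweedler_linear_map[OF F(2)] linear_map_scale[OF F(2)] ..
  finally show "sweedler A t (proj g a) F = sweedler A t a (\<lambda>x y. F x (proj g y))" .
  have "sweedler A t (proj g a) F = sweedler A t a (\<lambda>x y. sweedler A t y (\<lambda>y z. t (pc g x) (F y z)))"
    unfolding proj_left sweedler_linear_map[OF L] linear_map_scale[OF L] sc ..
  also have "\<dots> = sweedler A t a (\<lambda>x z. sweedler A t x (\<lambda>x y. t (pc g x) (F y z)))"
    by (rule sweedler_coassoc[symmetric]; intro multilinear)
  also have "\<dots> = sweedler A t a (\<lambda>x y. F (proj g x) y)"
    unfolding proj_left sweedler_linear_map[OF F(1)] linear_map_scale[OF F(1)] ..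
  finally show "sweedler A t (proj g a) F = sweedler A t a (\<lambda>x y. F (proj g x) y)" .
qed

lemma pc_proj: "pc g (proj h a) = (if g = h then pc g a else 0)"
proof -
  have L: "linear_map S (*) (pc g)" by (intro multilinear)
  show ?thesis
    unfolding proj_def sweedler_linear_map[OF L] linear_map_scale[OF L]
    using pc_comult[of a g h] by (simp add: mult.commute)
qed

lemma proj_proj: "proj g (proj h a) = (if g = h then proj g a else 0)"
proof -
  \<comment> \<open>Moving the inner projection to the leg on which \<open>pc g\<close> is evaluated
    reduces orthogonality of projections to that of coordinates.\<close>
  have "proj g (proj h a) = sweedler A S a (\<lambda>x y. S (pc g (proj h y)) x)"
    unfolding proj_def[of g "proj h a"] by (rule sweedler_proj; intro multilinear)
  then have eq: "proj g (proj h a) = sweedler A S a (\<lambda>x y. S (if g = h then pc g y else 0) x)"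
    by (simp only: pc_proj)
  show ?thesis
    unfolding eq by (cases "g = h") (simp_all add: proj_def sweedler_def lincomb_def case_prod_beta)
qed

lemma homog_iff: "a \<in> homog g \<longleftrightarrow> grade a = sg g a"
  by (simp add: component_def grade_def gtensor_basis[OF vector_space])

lemma homog_iff_proj: "a \<in> homog g \<longleftrightarrow> proj g a = a"
proof
  assume "a \<in> homog g"
  then have "Poly_Mapping.lookup (grade a) g = a" by (simp add: homog_iff)
  then show "proj g a = a" by (simp add: lookup_grade)
next
  assume a: "proj g a = a"
  \<comment> \<open>Orthogonality kills all other coordinates, so the single coordinate g determines
    the whole family \<open>grade a\<close>.\<close>
  have "proj h a = (if g = h then a else 0)" for h
    using proj_proj[of h g a] a by (cases "g = h") auto
  then show "a \<in> homog g"
    unfolding homog_iff by (intro poly_mapping_eqI) (auto simp: lookup_grade lookup_single when_def)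
qed

lemma proj_in_homog: "proj g a \<in> homog g"
  by (simp add: homog_iff_proj proj_proj)

text \<open>Adding the coefficients of an element of the group algebra is its counit, and p
  preserves counits; so the sum of all projections is the counit law. It also exhibits a left
  inverse of \<open>grade\<close>.\<close>

lemma graded_sum_grade: "graded_sum (grade a) (\<lambda>_ x. x) = a"
proof -
  have "graded_sum (gtensor A x w) (\<lambda>_ x. x) = S (lincomb (*) w (\<lambda>_. 1)) x" for x and w :: "'g \<Rightarrow>\<^sub>0 'k"
  proof -
    have "Poly_Mapping.keys (gtensor A x w) \<subseteq> Poly_Mapping.keys w"
      by (auto simp: in_keys_iff lookup_gtensor[OF vector_space])
    then have "graded_sum (gtensor A x w) (\<lambda>_ x. x) = (\<Sum>g\<in>Poly_Mapping.keys w. S (Poly_Mapping.lookup w g) x)"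
      by (subst graded_sum_superset) (auto simp: lookup_gtensor[OF vector_space])
    then show ?thesis by (simp add: lincomb_def vs.scale_sum_left)
  qed
  moreover have L: "linear_map (pm_scale S) S (\<lambda>u :: 'g \<Rightarrow>\<^sub>0 'a. graded_sum u (\<lambda>_ x. x))"
    by (intro multilinear)
  ultimately show ?thesis
    unfolding grade_def sweedler_linear_map[OF L] by (simp add: p_counit counit_right)
qed

lemma linear_map_eq_on_homog:
  assumes f: "linear_map S t f" and h: "linear_map S t h"
    and eq: "\<And>g a. a \<in> homog g \<Longrightarrow> f a = h a"
  shows "f a = h a"
  by (subst (1 2) graded_sum_grade[of a, symmetric])
    (simp add: graded_sum_def linear_map_sum[OF f] linear_map_sum[OF h] lookup_grade eq[OF proj_in_homog])

lemma sweedler_homog: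
  assumes a: "a \<in> homog g" and t: "vector_space t"
    and F: "\<And>y. linear_map S t (\<lambda>x. F x y)" "\<And>x. linear_map S t (\<lambda>y. F x y)"
  shows "sweedler A t a F = sweedler A t a (\<lambda>x y. F (proj g x) (proj g y))"
proof -
  note [multilinear] = linear_map_compose[OF _ F(1)] linear_map_compose[OF _ F(2)] t
  have "sweedler A t (proj g a) F = sweedler A t a (\<lambda>x y. F x (proj g y))"
    by (rule sweedler_proj; intro multilinear)
  \<comment> \<open>Reinserting a = \<open>proj g a\<close> after projecting the second leg allows
    the first leg to be projected as well.\<close>
  also have "\<dots> = sweedler A t (proj g a) (\<lambda>x y. F x (proj g y))"
    using a by (simp add: homog_iff_proj)
  also have "\<dots> = sweedler A t a (\<lambda>x y. F (proj g x) (proj g y))"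
    by (rule sweedler_proj; intro multilinear)
  finally show ?thesis using a by (simp add: homog_iff_proj)
qed

text \<open>The working form of the subcoalgebra property: two summands need to agree only on legs
  of degree g. Bilinearity of both is what permits inserting the projections.\<close>

lemma sweedler_homog_cong:
  assumes a: "a \<in> homog g" and t: "vector_space t"
    and F: "\<And>y. linear_map S t (\<lambda>x. F x y)" "\<And>x. linear_map S t (\<lambda>y. F x y)"
    and F': "\<And>y. linear_map S t (\<lambda>x. F' x y)" "\<And>x. linear_map S t (\<lambda>y. F' x y)"
    and eq: "\<And>x y. x \<in> homog g \<Longrightarrow> y \<in> homog g \<Longrightarrow> F x y = F' x y"
  shows "sweedler A t a F = sweedler A t a F'"
  unfolding sweedler_homog[OF a t, of F, OF F] sweedler_homog[OF a t, of F', OF F']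
  by (simp add: eq proj_in_homog)

text \<open>The coordinates of p(x) away from g vanish by \<open>pc_proj\<close>; the remaining one
  is the sum of all coordinates, hence the counit.\<close>

lemma p_homog: "x \<in> homog g \<Longrightarrow> p x = Poly_Mapping.single g (counit A x)"
proof -
  assume x: "x \<in> homog g"
  have p: "p x = Poly_Mapping.single g (pc g x)"
  proof (rule poly_mapping_eqI)
    fix k
    show "pc k x = Poly_Mapping.lookup (Poly_Mapping.single g (pc g x)) k"
      using pc_proj[where g = k and h = g and a = x] x
      by (cases "g = k") (auto simp: homog_iff_proj lookup_single)
  qed
  have "counit A x = lincomb (*) (Poly_Mapping.single g (pc g x)) (\<lambda>_. 1)"
    using p_counit[of x] p by simp
  also have "\<dots> = pc g x" by (simp add: lincomb_def)
  finally show ?thesis using p by simp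
qed

lemma homog_zero [simp]: "0 \<in> homog g"
  unfolding homog_iff_proj
  using linear_map_0[OF linear_map_proj[OF linear_map_ident[OF vector_space]]] by auto

section \<open>Degrees of the unit, of products, of the action and of the antipode\<close>

lemma homog_one: "hone A \<in> homog 0"
  unfolding homog_iff grade_def
  using gtensor_basis[OF vector_space, of "hone A" "0 :: 'g"]
  by (subst sweedler_one; (intro multilinear)?) (simp add: p_one)

lemma gtensor_single: "gtensor A a (sg g c) = sg g (S c a)"
  by (rule poly_mapping_eqI) (simp add: lookup_gtensor[OF vector_space] lookup_single when_def)

lemma homog_mult:
  assumes a: "a \<in> homog g" and b: "b \<in> homog h"
  shows "hmult A a b \<in> homog (g + h)"
proof -
  let ?P = "pm_scale S"
  have sgl: "linear_map S ?P (sg (g + h))" by (intro multilinear)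
  have "grade (hmult A a b) = sweedler A ?P a (\<lambda>x y. sweedler A ?P b
      (\<lambda>x' y'. gtensor A (hmult A x x') (p (hmult A y y'))))"
    unfolding grade_def by (rule sweedler_mult; intro multilinear)
  \<comment> \<open>On homogeneous legs p(y y') is the counit of y times that of y' at g + h, so the
    grading of the product collapses by the counit laws.\<close>
  also have "\<dots> = sweedler A ?P a (\<lambda>x y. sweedler A ?P b
      (\<lambda>x' y'. sg (g + h) (S (counit A y) (S (counit A y') (hmult A x x')))))"
    by (rule sweedler_homog_cong[OF a]; (intro multilinear)?)
      (rule sweedler_homog_cong[OF b]; (intro multilinear)?;
        simp add: p_mult p_homog mult_single gtensor_single)
  also have "\<dots> = sg (g + h) (sweedler A S a (\<lambda>x y. S (counit A y) (sweedler A S b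
      (\<lambda>x' y'. S (counit A y') (hmult A x x')))))"
    by (simp add: sweedler_linear_map[OF sgl] sweedler_scale_left)
  also have "\<dots> = sg (g + h) (hmult A a b)"
  proof -
    have "sweedler A S b (\<lambda>x' y'. S (counit A y') (hmult A x x')) = hmult A x b" for x
      by (rule sweedler_counit_right) (intro multilinear)
    moreover have "sweedler A S a (\<lambda>x y. S (counit A y) (hmult A x b)) = hmult A a b"
      by (rule sweedler_counit_right) (intro multilinear)
    ultimately show ?thesis by simp
  qed
  finally show ?thesis by (simp add: homog_iff)
qed

text \<open>\<alpha>_g is a coalgebra map, and the invariance of p under \<alpha>_g keeps the
  coordinates of the second leg.\<close>

lemma proj_action: "proj h (\<alpha> g a) = \<alpha> g (proj h a)"
proof -
  have L: "linear_map S S (\<alpha> g)" by (intro multilinear)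
  have "proj h (\<alpha> g a) = sweedler A S a (\<lambda>x y. S (pc h (\<alpha> g y)) (\<alpha> g x))"
    unfolding proj_def by (rule sweedler_hopf_hom[OF action_hopf_hom]; intro multilinear)
  then show ?thesis
    unfolding proj_def sweedler_linear_map[OF L] linear_map_scale[OF L] by (simp add: p_action)
qed

lemma homog_action: "a \<in> homog h \<Longrightarrow> \<alpha> g a \<in> homog h"
  by (simp add: homog_iff_proj proj_action)

lemma proj_mult_homog:
  assumes y: "y \<in> homog g"
  shows "hmult A (proj h x) y = proj (h + g) (hmult A x y)"
proof (rule linear_map_eq_on_homog[of S _ _ x])
  fix k x assume x: "x \<in> homog k"
  have "proj h x = (if h = k then x else 0)"
    using x proj_proj[of h k x] by (auto simp: homog_iff_proj)
  moreover have "proj (h + g) (hmult A x y) = (if h = k then hmult A x y else 0)"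
    using homog_mult[OF x y] proj_proj[of "h + g" "k + g" "hmult A x y"] by (auto simp: homog_iff_proj)
  ultimately show "hmult A (proj h x) y = proj (h + g) (hmult A x y)" by simp
qed (intro multilinear)+

lemma graded_sum_grade_homog:
  "a \<in> homog g \<Longrightarrow> F g 0 = 0 \<Longrightarrow> graded_sum (grade a) F = F g a"
  by (simp add: homog_iff graded_sum_single)

text \<open>Forcing the antipode to respect the grading yields another left antipode, hence the antipode
  itself; no anticomultiplicativity of the antipode is needed.\<close>

lemma homog_antipode:
  assumes "a \<in> homog g"
  shows "antipode A a \<in> homog (- g)"
proof -
  define T where "T a = graded_sum (grade a) (\<lambda>g x. proj (- g) (antipode A x))" for a
  have T[multilinear]: "linear_map r S f \<Longrightarrow> linear_map r S (\<lambda>x. T (f x))" for r :: "'k \<Rightarrow> 'x::ab_group_add \<Rightarrow> 'x" and f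
    unfolding T_def by (assumption | intro multilinear)+
  have T0: "T x = proj (- g) (antipode A x)" if "x \<in> homog g" for x g
    unfolding T_def using that linear_map_0[OF linear_map_proj[OF antipode_linear]]
    by (intro graded_sum_grade_homog)
  have "T = antipode A"
  proof (rule left_antipode_unique)
    show "linear_map S S T" by (intro multilinear)
    show "sweedler A S a (\<lambda>x y. hmult A (T x) y) = S (counit A a) (hone A)" for a
    proof (rule linear_map_eq_on_homog[of S _ _ a])
      fix g a assume a: "a \<in> homog g"
      have p0: "linear_map S S (proj 0)" by (intro multilinear)
      \<comment> \<open>As y has degree g, projecting S(x) to degree -g is projecting S(x) y to
        degree 0; the sum of these products is a multiple of the unit, which already has degree
        0.\<close>
      have "sweedler A S a (\<lambda>x y. hmult A (T x) y) = sweedler A S a (\<lambda>x y. proj 0 (hmult A (antipode A x) y))"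
        by (rule sweedler_homog_cong[OF a]; (intro multilinear)?) (simp add: T0 proj_mult_homog)
      also have "\<dots> = proj 0 (S (counit A a) (hone A))"
        unfolding antipode_left[symmetric] by (rule sweedler_linear_map[symmetric]) (intro multilinear)
      also have "\<dots> = S (counit A a) (hone A)"
        using homog_one by (simp add: linear_map_scale[OF p0] homog_iff_proj)
      finally show "sweedler A S a (\<lambda>x y. hmult A (T x) y) = S (counit A a) (hone A)" .
    qed (intro multilinear)+
  qed
  then show ?thesis using T0[OF assms] proj_in_homog by metis
qed

end

section \<open>Convolution\<close>

context hopf_algebra
begin

lemma linear_map_conv:
  assumes "linear_map (hscale H) (*) f" "linear_map (hscale H) (*) h"
  shows "linear_map (hscale H) (*) (conv H f h)"
proof -
  note [multilinear] = linear_map_compose[OF _ assms(1)] linear_map_compose[OF _ assms(2)]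
  show ?thesis unfolding conv_def by (intro multilinear)
qed

lemma conv_assoc:
  assumes "linear_map (hscale H) (*) f" "linear_map (hscale H) (*) g" "linear_map (hscale H) (*) h"
  shows "conv H (conv H f g) h = conv H f (conv H g h)"
proof
  fix a
  note [multilinear] = linear_map_compose[OF _ assms(1)] linear_map_compose[OF _ assms(2)]
    linear_map_compose[OF _ assms(3)]
  have "sweedler H (*) a (\<lambda>x z. sweedler H (*) x (\<lambda>x y. f x * (g y * h z))) =
      sweedler H (*) a (\<lambda>x y. sweedler H (*) y (\<lambda>y z. f x * (g y * h z)))"
    by (rule sweedler_coassoc; intro multilinear)
  then show "conv H (conv H f g) h a = conv H f (conv H g h) a"
    by (simp add: conv_def sweedler_mult_left sweedler_mult_right mult.assoc)
qed

lemma conv_counit: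
  assumes "linear_map (hscale H) (*) f"
  shows "conv H (counit H) f = f" "conv H f (counit H) = f"
  using sweedler_counit_left[OF assms] sweedler_counit_right[OF assms]
  by (auto simp: conv_def mult.commute)

section \<open>Characters and bilinear forms under convolution\<close>

lemma H1_iff:
  "\<omega> \<in> carrier (H1 H) \<longleftrightarrow> linear_map (hscale H) (*) \<omega> \<and>
     (\<forall>a b. \<omega> (hmult H a b) = \<omega> a * \<omega> b) \<and> \<omega> (hone H) = 1"
  by (simp add: H1_def)

text \<open>The algebra map \<omega> is applied to the two antipode laws.\<close>

lemma conv_antipode:
  assumes \<omega>: "\<omega> \<in> carrier (H1 H)"
  shows "conv H (\<lambda>a. \<omega> (antipode H a)) \<omega> = counit H" "conv H \<omega> (\<lambda>a. \<omega> (antipode H a)) = counit H"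
proof -
  have L: "linear_map (hscale H) (*) \<omega>" and m: "\<omega> a * \<omega> b = \<omega> (hmult H a b)" and "\<omega> (hone H) = 1" for a b
    using \<omega> by (auto simp: H1_iff)
  then show "conv H (\<lambda>a. \<omega> (antipode H a)) \<omega> = counit H" "conv H \<omega> (\<lambda>a. \<omega> (antipode H a)) = counit H"
    by (auto simp: conv_def m antipode_left antipode_right linear_map_scale[OF L]
        simp flip: sweedler_linear_map[OF L])
qed

text \<open>The legs of a and b are regrouped separately; exchanging sums brings the nested sums
  over one element together, so that coassociativity applies to each.\<close>

lemma conv2_assoc:
  assumes "bilinear_form H F" "bilinear_form H G" "bilinear_form H W"
  shows "conv2 H (conv2 H F G) W = conv2 H F (conv2 H G W)"
proof (intro ext)
  fix a b
  note b = assms[unfolded bilinear_form_def]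
  note [multilinear] = bilinear_mapD[OF b(1)] bilinear_mapD[OF b(2)] bilinear_mapD[OF b(3)]
  have b: "sweedler H (*) b (\<lambda>y w. sweedler H (*) y (\<lambda>v v'. F u v * (G u' v' * W z w))) =
      sweedler H (*) b (\<lambda>v r. sweedler H (*) r (\<lambda>v' w. F u v * (G u' v' * W z w)))" for u u' z
    by (rule sweedler_coassoc; intro multilinear)
  have "conv2 H (conv2 H F G) W a b = sweedler H (*) a (\<lambda>x z. sweedler H (*) b (\<lambda>y w.
      sweedler H (*) x (\<lambda>u u'. sweedler H (*) y (\<lambda>v v'. F u v * (G u' v' * W z w)))))"
    by (simp add: conv2_def sweedler_mult_right mult.assoc)
  also have "\<dots> = sweedler H (*) a (\<lambda>x z. sweedler H (*) x (\<lambda>u u'. sweedler H (*) b (\<lambda>v r.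
      sweedler H (*) r (\<lambda>v' w. F u v * (G u' v' * W z w)))))"
    unfolding b[symmetric] by (subst sweedler_swap[OF vector_space_mult, of H _ H b]) (rule refl)
  also have "\<dots> = sweedler H (*) a (\<lambda>u q. sweedler H (*) q (\<lambda>u' z. sweedler H (*) b (\<lambda>v r.
      sweedler H (*) r (\<lambda>v' w. F u v * (G u' v' * W z w)))))"
    by (rule sweedler_coassoc; intro multilinear)
  also have "\<dots> = sweedler H (*) a (\<lambda>u q. sweedler H (*) b (\<lambda>v r. sweedler H (*) q (\<lambda>u' z.
      sweedler H (*) r (\<lambda>v' w. F u v * (G u' v' * W z w)))))"
    by (subst sweedler_swap[OF vector_space_mult, of H _ H b]) (rule refl)
  also have "\<dots> = conv2 H F (conv2 H G W) a b"
    by (simp add: conv2_def sweedler_mult_left)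
  finally show "conv2 H (conv2 H F G) W a b = conv2 H F (conv2 H G W) a b" .
qed

lemma conv2_counit:
  assumes "bilinear_form H F"
  shows "conv2 H (\<lambda>a b. counit H a * counit H b) F = F" "conv2 H F (\<lambda>a b. counit H a * counit H b) = F"
proof -
  note b = assms[unfolded bilinear_form_def]
  note [multilinear] = bilinear_mapD[OF b]
  have l: "sweedler H (*) a (\<lambda>x y. counit H x * F y c) = F a c"
    "sweedler H (*) a (\<lambda>x y. counit H x * F c y) = F c a" for a c
    by (rule sweedler_counit_left; intro multilinear)+
  have r: "sweedler H (*) a (\<lambda>x y. counit H y * F x c) = F a c"
    "sweedler H (*) a (\<lambda>x y. counit H y * F c x) = F c a" for a c
    by (rule sweedler_counit_right; intro multilinear)+
  have "conv2 H (\<lambda>a b. counit H a * counit H b) F a b = F a b" for a b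
    unfolding conv2_def mult.assoc sweedler_mult_left[symmetric] l ..
  moreover have "conv2 H F (\<lambda>a b. counit H a * counit H b) a b = F a b" for a b
    unfolding conv2_def mult.commute[of "F _ _"] mult.assoc sweedler_mult_left[symmetric] r ..
  ultimately show "conv2 H (\<lambda>a b. counit H a * counit H b) F = F" "conv2 H F (\<lambda>a b. counit H a * counit H b) = F"
    by (simp_all add: fun_eq_iff)
qed

lemma conv2_left_right_inverse:
  assumes "bilinear_form H F" "bilinear_form H G" "bilinear_form H W"
    and "conv2 H F W = (\<lambda>a b. counit H a * counit H b)" "conv2 H W G = (\<lambda>a b. counit H a * counit H b)"
  shows "F = G"
  using conv2_assoc[OF assms(1,3,2)] assms by (simp add: conv2_counit)

text \<open>\<open>twisted_mult\<close> refers to the inverse of \<sigma> by a definite description,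
  which uniqueness resolves.\<close>

lemma the_conv2_inverse:
  assumes "conv2_inverse H \<sigma> \<tau>"
  shows "(THE \<tau>. conv2_inverse H \<sigma> \<tau>) = \<tau>"
proof (rule the_equality)
  show "conv2_inverse H \<sigma> \<tau>" by fact
  fix \<tau>' assume "conv2_inverse H \<sigma> \<tau>'"
  with assms show "\<tau>' = \<tau>"
    unfolding conv2_inverse_def by (intro conv2_left_right_inverse[of \<tau>' \<tau> \<sigma>]) auto
qed

text \<open>Both sides of the multiplicativity of \<open>\<omega> \<circ> antipode\<close> are convolution inverse to
  \<open>a \<otimes> b \<mapsto> \<omega> (a b)\<close>.\<close>

lemma H1_antipode:
  assumes \<omega>: "\<omega> \<in> carrier (H1 H)"
  shows "(\<lambda>a. \<omega> (antipode H a)) \<in> carrier (H1 H)"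
proof -
  have L: "linear_map (hscale H) (*) \<omega>" and m: "\<omega> (hmult H a b) = \<omega> a * \<omega> b"
    and one: "\<omega> (hone H) = 1" for a b
    using \<omega> by (auto simp: H1_iff)
  note [multilinear] = linear_map_compose[OF _ L]
  let ?F = "\<lambda>a b. \<omega> (antipode H (hmult H a b))" and ?W = "\<lambda>a b. \<omega> a * \<omega> b"
    and ?G = "\<lambda>a b. \<omega> (antipode H a) * \<omega> (antipode H b)"
  have "?F = ?G"
  proof (rule conv2_left_right_inverse)
    show "bilinear_form H ?F" "bilinear_form H ?G" "bilinear_form H ?W"
      unfolding bilinear_form_def by (intro bilinear_mapI multilinear)+
    have "conv2 H ?F ?W a b = counit H a * counit H b" for a b
    proof -
      \<comment> \<open>Since the coproduct is multiplicative, this convolution is the antipode law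
        at the product of a and b.\<close>
      have "conv2 H ?F ?W a b = sweedler H (*) (hmult H a b) (\<lambda>x y. \<omega> (hmult H (antipode H x) y))"
        by (subst sweedler_mult; (intro multilinear)?) (simp add: conv2_def m)
      also have "\<dots> = counit H a * counit H b"
        unfolding sweedler_linear_map[OF L, symmetric] antipode_left
        by (simp add: linear_map_scale[OF L] one counit_mult)
      finally show ?thesis .
    qed
    then show "conv2 H ?F ?W = (\<lambda>a b. counit H a * counit H b)" by blast
    have c: "sweedler H (*) a (\<lambda>x y. \<omega> x * \<omega> (antipode H y)) = counit H a" for a
      using fun_cong[OF conv_antipode(2)[OF \<omega>], of a] by (simp add: conv_def)
    have "conv2 H ?W ?G a b = counit H a * counit H b" for a b
    proof -
      \<comment> \<open>Scalars commute, so the sum splits into one factor for a and one for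
        b.\<close>
      have "conv2 H ?W ?G a b = sweedler H (*) a (\<lambda>x x'. sweedler H (*) b (\<lambda>y y'.
          (\<omega> x * \<omega> (antipode H x')) * (\<omega> y * \<omega> (antipode H y'))))"
        by (simp add: conv2_def mult_ac)
      then show ?thesis
        by (simp add: c flip: sweedler_mult_left sweedler_mult_right)
    qed
    then show "conv2 H ?W ?G = (\<lambda>a b. counit H a * counit H b)" by blast
  qed
  then have "\<omega> (antipode H (hmult H a b)) = \<omega> (antipode H a) * \<omega> (antipode H b)" for a b
    by metis
  moreover have "\<omega> (antipode H (hone H)) = 1"
    using fun_cong[OF conv_antipode(1)[OF \<omega>], of "hone H"] unfolding conv_def
    by (subst (asm) sweedler_one; (intro multilinear)?) (simp add: one counit_one)
  moreover have "linear_map (hscale H) (*) (\<lambda>a. \<omega> (antipode H a))" by (intro multilinear)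
  ultimately show ?thesis by (simp add: H1_iff)
qed

text \<open>Needed so that \<open>inv\<close>, as used in the conjugation formula, is a two-sided
  convolution inverse and again a linear map.\<close>

lemma group_H1: "group (H1 H)"
proof (rule groupI)
  fix \<omega> \<eta> assume "\<omega> \<in> carrier (H1 H)" "\<eta> \<in> carrier (H1 H)"
  then have L: "linear_map (hscale H) (*) \<omega>" "linear_map (hscale H) (*) \<eta>"
    and m: "\<omega> (hmult H a b) = \<omega> a * \<omega> b" "\<eta> (hmult H a b) = \<eta> a * \<eta> b"
    and one: "\<omega> (hone H) = 1" "\<eta> (hone H) = 1" for a b
    by (auto simp: H1_iff)
  note [multilinear] = linear_map_compose[OF _ L(1)] linear_map_compose[OF _ L(2)]
  have "conv H \<omega> \<eta> (hmult H a b) = conv H \<omega> \<eta> a * conv H \<omega> \<eta> b" for a b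
  proof -
    have eq: "(\<omega> x * \<omega> x') * (\<eta> y * \<eta> y') = (\<omega> x * \<eta> y) * (\<omega> x' * \<eta> y')" for x x' y y'
      by (simp add: mult_ac)
    then show ?thesis
      unfolding conv_def
      by (subst sweedler_mult; (intro multilinear)?)
        (simp add: m eq flip: sweedler_mult_left sweedler_mult_right)
  qed
  moreover have "conv H \<omega> \<eta> (hone H) = 1"
    unfolding conv_def by (subst sweedler_one; (intro multilinear)?) (simp add: one)
  moreover have "linear_map (hscale H) (*) (conv H \<omega> \<eta>)" by (intro linear_map_conv L)
  ultimately have "conv H \<omega> \<eta> \<in> carrier (H1 H)" by (simp add: H1_iff)
  then show "\<omega> \<otimes>\<^bsub>H1 H\<^esub> \<eta> \<in> carrier (H1 H)" by (simp add: H1_def)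
next
  show "\<one>\<^bsub>H1 H\<^esub> \<in> carrier (H1 H)" by (simp add: H1_def counit_linear counit_mult counit_one)
next
  fix \<omega> assume \<omega>: "\<omega> \<in> carrier (H1 H)"
  then show "\<one>\<^bsub>H1 H\<^esub> \<otimes>\<^bsub>H1 H\<^esub> \<omega> = \<omega>" by (simp add: H1_def conv_counit)
  show "\<exists>\<eta>\<in>carrier (H1 H). \<eta> \<otimes>\<^bsub>H1 H\<^esub> \<omega> = \<one>\<^bsub>H1 H\<^esub>"
    using H1_antipode[OF \<omega>] conv_antipode(1)[OF \<omega>] by (intro bexI) (simp add: H1_def)
qed (simp add: H1_def conv_assoc)

end

section \<open>The twist by an almost adjoint action\<close>

lemma sweedler_update [simp]:
  "sweedler (H\<lparr>hmult := m, antipode := T\<rparr>) t a F = sweedler H t a F"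
  by (simp add: sweedler_def)

text \<open>Resolves the definite description in \<open>twist\<close>, by
  \<open>left_antipode_unique\<close> for the changed product.\<close>

lemma the_antipode:
  assumes "hopf_algebra (H\<lparr>hmult := m, antipode := T\<rparr>)"
  shows "(THE T. hopf_algebra (H\<lparr>hmult := m, antipode := T\<rparr>)) = T"
proof (rule the_equality)
  fix T' assume T': "hopf_algebra (H\<lparr>hmult := m, antipode := T'\<rparr>)"
  interpret hopf_algebra "H\<lparr>hmult := m, antipode := T\<rparr>" by fact
  interpret T': hopf_algebra "H\<lparr>hmult := m, antipode := T'\<rparr>" by fact
  show "T' = T"
    using left_antipode_unique[of T'] T'.antipode_linear T'.antipode_left by simp
qed fact

section \<open>The graded product and its image in the crossed product\<close>

context cocentral_action
begin

text \<open>The crossed product multiplication pulled back along \<open>grade\<close>; summing over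
  the parts of a makes the rule for homogeneous a linear on all of A.\<close>

definition tmult :: "'a \<Rightarrow> 'a \<Rightarrow> 'a" where
  "tmult a b = graded_sum (grade a) (\<lambda>g x. hmult A x (\<alpha> g b))"

text \<open>Likewise the pullback of the antipode of the crossed product.\<close>

definition tantipode :: "'a \<Rightarrow> 'a" where
  "tantipode a = graded_sum (grade a) (\<lambda>g x. antipode A (\<alpha> (- g) x))"

abbreviation At where "At \<equiv> A\<lparr>hmult := tmult, antipode := tantipode\<rparr>"

lemma linear_map_tmult [multilinear]:
  "linear_map r S f \<Longrightarrow> linear_map r S (\<lambda>x. tmult (f x) b)"
  "linear_map r S f \<Longrightarrow> linear_map r S (\<lambda>x. tmult a (f x))"
proof -
  assume f: "linear_map r S f"
  then have r: "vector_space r" by (simp add: linear_map_iff)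
  show "linear_map r S (\<lambda>x. tmult (f x) b)" "linear_map r S (\<lambda>x. tmult a (f x))"
    unfolding tmult_def by (intro multilinear f r)+
qed

lemma linear_map_tantipode [multilinear]:
  "linear_map r S f \<Longrightarrow> linear_map r S (\<lambda>x. tantipode (f x))"
  unfolding tantipode_def by (assumption | intro multilinear)+

lemma tmult_homog: "a \<in> homog g \<Longrightarrow> tmult a b = hmult A a (\<alpha> g b)"
  unfolding tmult_def by (intro graded_sum_grade_homog) auto

lemma tantipode_homog: "a \<in> homog g \<Longrightarrow> tantipode a = antipode A (\<alpha> (- g) a)"
  unfolding tantipode_def
  by (intro graded_sum_grade_homog) (auto simp: action_simps linear_map_0[OF antipode_linear])

lemma tantipode_in_homog: "a \<in> homog g \<Longrightarrow> tantipode a \<in> homog (- g)"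
  by (simp add: tantipode_homog homog_antipode homog_action)

lemma hopf_algebra_twist: "hopf_algebra At"
proof (rule hopf_algebraI, simp_all)
  show "vector_space S" by (rule vector_space)
  show "bilinear_map S S S tmult" by (intro bilinear_mapI multilinear)
  show "tmult (tmult a b) c = tmult a (tmult b c)" for a b c
  proof (rule linear_map_eq_on_homog[of S _ _ a])
    fix g a assume a: "a \<in> homog g"
    show "tmult (tmult a b) c = tmult a (tmult b c)"
    proof (rule linear_map_eq_on_homog[of S _ _ b])
      fix h b assume b: "b \<in> homog h"
      show "tmult (tmult a b) c = tmult a (tmult b c)"
        \<comment> \<open>\<alpha>_g(b) keeps degree h, so the product of a with it has degree g +
          h, and \<alpha>_{g+h} then acts on c as \<alpha>_g after \<alpha>_h.\<close>
        by (simp add: tmult_homog[OF a] tmult_homog[OF b] tmult_homog[OF homog_mult[OF a homog_action[OF b]]]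
            action_simps action_add mult_assoc)
    qed (intro multilinear)+
  qed (intro multilinear)+
  show "tmult (hone A) a = a" for a
    by (simp add: tmult_homog[OF homog_one] action_simps mult_one_left)
  show "tmult a (hone A) = a" for a
    by (rule linear_map_eq_on_homog[of S _ _ a]; (intro multilinear)?)
      (simp add: tmult_homog action_simps mult_one_right)
  show "comult A a \<in> tensor_space S S" for a by (rule comult_in)
  show "linear_map S (*) (counit A)" by (rule counit_linear)
  show "sweedler A S a (\<lambda>x. S (counit A x)) = a" "sweedler A S a (\<lambda>x y. S (counit A y) x) = a" for a
    by (rule counit_left counit_right)+
  show "counit A (hone A) = 1" by (rule counit_one)
  show "linear_map S S tantipode" by (intro multilinear)
  show "counit A (tmult a b) = counit A a * counit A b" for a b
    by (rule linear_map_eq_on_homog[of "(*)" _ _ a]; (intro multilinear)?)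
      (simp add: tmult_homog action_simps counit_mult)
  show "sweedler A S a (\<lambda>x y. tmult (tantipode x) y) = S (counit A a) (hone A)" for a
  proof (rule linear_map_eq_on_homog[of S _ _ a])
    fix g a assume a: "a \<in> homog g"
    have L: "linear_map S S (\<alpha> (- g))" by (intro multilinear)
    \<comment> \<open>\<open>tantipode x\<close> has degree -g, so the product applies \<alpha>_{-g}
      to y; it also commutes with the antipode and becomes a common factor.\<close>
    have "sweedler A S a (\<lambda>x y. tmult (tantipode x) y) =
        sweedler A S a (\<lambda>x y. \<alpha> (- g) (hmult A (antipode A x) y))"
      by (rule sweedler_homog_cong[OF a]; (intro multilinear)?)
        (simp add: tmult_homog[of _ "- g"] homog_antipode homog_action tantipode_homog action_simps)
    also have "\<dots> = S (counit A a) (hone A)"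
      unfolding sweedler_linear_map[OF L, symmetric] antipode_left by (simp add: action_simps)
    finally show "sweedler A S a (\<lambda>x y. tmult (tantipode x) y) = S (counit A a) (hone A)" .
  qed (intro multilinear)+
  show "sweedler A S a (\<lambda>x y. tmult x (tantipode y)) = S (counit A a) (hone A)" for a
  proof (rule linear_map_eq_on_homog[of S _ _ a])
    fix g a assume a: "a \<in> homog g"
    have "sweedler A S a (\<lambda>x y. tmult x (tantipode y)) = sweedler A S a (\<lambda>x y. hmult A x (antipode A y))"
      by (rule sweedler_homog_cong[OF a]; (intro multilinear)?)
        (simp add: tmult_homog tantipode_homog action_simps flip: action_add)
    then show "sweedler A S a (\<lambda>x y. tmult x (tantipode y)) = S (counit A a) (hone A)"
      by (simp add: antipode_right)
  qed (intro multilinear)+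
next
  fix F :: "'a \<Rightarrow> 'a \<Rightarrow> 'k"
  assume "bilinear_map S S (*) F"
  note [multilinear] = bilinear_mapD[OF this]
  show "linear_map S (*) (\<lambda>u. sweedler A (*) u F)" by (intro multilinear)
  show "sweedler A (*) (hone A) F = F (hone A) (hone A)"
    by (rule sweedler_one; intro multilinear)
  show "sweedler A (*) (tmult a b) F =
    sweedler A (*) a (\<lambda>x y. sweedler A (*) b (\<lambda>x' y'. F (tmult x x') (tmult y y')))" for a b
  proof (rule linear_map_eq_on_homog[of "(*)" _ _ a])
    fix g a assume a: "a \<in> homog g"
    have "sweedler A (*) (tmult a b) F = sweedler A (*) a (\<lambda>x y. sweedler A (*) b
        (\<lambda>x' y'. F (hmult A x (\<alpha> g x')) (hmult A y (\<alpha> g y'))))"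
      unfolding tmult_homog[OF a]
      by (subst sweedler_mult, (intro multilinear)+,
          subst sweedler_hopf_hom[OF action_hopf_hom], (intro multilinear)+, rule refl)
    \<comment> \<open>Both legs of a have degree g, so \<open>tmult\<close> uses the same \<alpha>_g
      on the two legs of b.\<close>
    also have "\<dots> = sweedler A (*) a (\<lambda>x y. sweedler A (*) b (\<lambda>x' y'. F (tmult x x') (tmult y y')))"
      by (rule sweedler_homog_cong[OF a]; (intro multilinear)?) (simp add: tmult_homog)
    finally show "sweedler A (*) (tmult a b) F =
      sweedler A (*) a (\<lambda>x y. sweedler A (*) b (\<lambda>x' y'. F (tmult x x') (tmult y y')))" .
  qed (intro multilinear)+
next
  fix F :: "'a \<Rightarrow> 'a \<Rightarrow> 'a \<Rightarrow> 'k" and u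
  assume "trilinear_form S F"
  then show "sweedler A (*) u (\<lambda>x z. sweedler A (*) x (\<lambda>x y. F x y z)) =
      sweedler A (*) u (\<lambda>x y. sweedler A (*) y (F x))"
    by (intro sweedler_coassoc multilinear) (auto simp: trilinear_form_def)
qed

text \<open>On a homogeneous a the map is a \<otimes> g, so each compatibility becomes a formula for
  crossed product operations on elementary tensors.\<close>

lemma hopf_hom_grade: "hopf_hom At C grade"
  unfolding hopf_hom_def
proof (intro conjI allI)
  show "linear_map (hscale At) (hscale C) grade"
    by (simp add: crossed_product_simps(1), intro multilinear)
  show "grade (hmult At a b) = hmult C (grade a) (grade b)" for a b
  proof -
    have "grade (tmult a b) = hmult C (grade a) (grade b)"
    proof (rule linear_map_eq_on_homog[of "pm_scale S" _ _ a])
      fix g a assume a: "a \<in> homog g"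
      show "grade (tmult a b) = hmult C (grade a) (grade b)"
      proof (rule linear_map_eq_on_homog[of "pm_scale S" _ _ b])
        fix h b assume b: "b \<in> homog h"
        show "grade (tmult a b) = hmult C (grade a) (grade b)"
          using a b homog_mult[OF a homog_action[OF b, of g]]
          by (simp add: tmult_homog[OF a] homog_iff crossed_single)
      qed (intro multilinear)+
    qed (intro multilinear)+
    then show ?thesis by simp
  qed
  show "grade (hone At) = hone C"
    using homog_one by (simp add: homog_iff crossed_product_simps(2))
  show "counit C (grade a) = counit At a" for a
  proof -
    have "counit C (grade a) = counit A a"
      by (rule linear_map_eq_on_homog[of "(*)" _ _ a]; (intro multilinear)?)
        (simp add: homog_iff crossed_single)
    then show ?thesis by simp
  qed
  show "grade (antipode At a) = antipode C (grade a)" for a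
  proof -
    have "grade (tantipode a) = antipode C (grade a)"
    proof (rule linear_map_eq_on_homog[of "pm_scale S" _ _ a])
      fix g a assume a: "a \<in> homog g"
      show "grade (tantipode a) = antipode C (grade a)"
        using tantipode_in_homog[OF a] a by (simp add: homog_iff crossed_single tantipode_homog[OF a])
    qed (intro multilinear)+
    then show ?thesis by simp
  qed
  show "comult C (grade a) = hclass C (sweedler At fscale a (\<lambda>x y. basis (grade x, grade y)))" for a
  proof (rule comult_homI, unfold crossed_product_simps(1))
    show "vector_space (pm_scale S)" by (intro multilinear)
    show "comult C (grade a) \<in> tensor_space (pm_scale S) (pm_scale S)"
      by (simp add: crossed_product_simps tensor_space_def)
    fix F :: "('g \<Rightarrow>\<^sub>0 'a) \<Rightarrow> ('g \<Rightarrow>\<^sub>0 'a) \<Rightarrow> 'k"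
    assume "bilinear_map (pm_scale S) (pm_scale S) (*) F"
    note [multilinear] = bilinear_mapD[OF this]
    have "sweedler C (*) (grade a) F = sweedler A (*) a (\<lambda>x y. F (grade x) (grade y))"
    proof (rule linear_map_eq_on_homog[of "(*)" _ _ a])
      fix g a assume a: "a \<in> homog g"
      then have "sweedler C (*) (grade a) F = sweedler C (*) (sg g a) F" by (simp add: homog_iff)
      also have "\<dots> = sweedler A (*) a (\<lambda>x y. F (sg g x) (sg g y))"
        by (rule sweedler_single; intro multilinear)
      also have "\<dots> = sweedler A (*) a (\<lambda>x y. F (grade x) (grade y))"
        by (rule sweedler_homog_cong[OF a]; (intro multilinear)?) (simp add: homog_iff)
      finally show "sweedler C (*) (grade a) F = sweedler A (*) a (\<lambda>x y. F (grade x) (grade y))" .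
    qed (intro multilinear)+
    then show "sweedler C (*) (grade a) F = sweedler At (*) a (\<lambda>x y. F (grade x) (grade y))"
      by simp
  qed
qed

lemma inj_grade: "inj grade"
  by (metis injI graded_sum_grade)

text \<open>A homogeneous a has image a \<otimes> g, and conversely \<open>grade a\<close> is the
  sum of the elementary tensors of its projections.\<close>

lemma range_grade: "range grade = graded_twisting A p \<alpha>"
proof -
  interpret P: vector_space "pm_scale S :: 'k \<Rightarrow> ('g \<Rightarrow>\<^sub>0 'a) \<Rightarrow> _" by (intro multilinear)
  have L: "linear_map S (pm_scale S) grade" by (intro multilinear)
  interpret L: Vector_Spaces.linear S "pm_scale S" grade by (rule L)
  let ?G = "{sg g a | g a. a \<in> homog g}"
  have "P.span ?G = range grade"
  proof
    have "?G \<subseteq> range grade"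
    proof clarify
      fix g a assume "a \<in> homog g"
      then have "sg g a = grade a" by (simp add: homog_iff)
      then show "sg g a \<in> range grade" by simp
    qed
    then show "P.span ?G \<subseteq> range grade"
      using L.subspace_image[OF vs.subspace_UNIV] by (rule P.span_minimal)
    have "grade a \<in> P.span ?G" for a
    proof -
      have "grade a = (\<Sum>g\<in>Poly_Mapping.keys (grade a). sg g (proj g a))"
        using graded_sum_single_self[of "grade a"] by (simp add: graded_sum_def lookup_grade)
      also have "\<dots> \<in> P.span ?G"
        using proj_in_homog by (intro P.span_sum P.span_base) blast
      finally show ?thesis .
    qed
    then show "range grade \<subseteq> P.span ?G" by blast
  qed
  then show ?thesis by (simp add: graded_twisting_def crossed_product_simps(1))
qed

lemma hopf_iso_onto_grade: "hopf_iso_onto At C (graded_twisting A p \<alpha>) grade"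
  unfolding hopf_iso_onto_def range_grade[symmetric]
  by (intro conjI hopf_algebra_twist hopf_algebra_crossed_product hopf_hom_grade inj_grade refl
      hopf_subalgebra_range[OF hopf_algebra_twist])

end

section \<open>The form \<sigma> and the identification of the twist\<close>

locale almost_adjoint_action = cocentral_action A \<alpha> p
  for A :: "('k::field, 'a::ab_group_add) hopf" and \<alpha> :: "'g::group_add \<Rightarrow> 'a \<Rightarrow> 'a" and p +
  fixes \<phi> :: "'g \<Rightarrow> 'a \<Rightarrow> 'k"
  assumes \<phi>_H1: "\<phi> g \<in> carrier (H1 A)"
    and action_conjugation: "\<alpha> g a = sweedler3 A S a (\<lambda>x y z. S ((inv\<^bsub>H1 A\<^esub> (\<phi> g)) x * \<phi> g z) y)"
begin

abbreviation \<psi> where "\<psi> g \<equiv> inv\<^bsub>H1 A\<^esub> (\<phi> g)"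
abbreviation \<sigma> where "\<sigma> a b \<equiv> linear_extension \<psi> (p a) b"
abbreviation \<tau> where "\<tau> a b \<equiv> linear_extension \<phi> (p a) b"

lemma \<phi>_linear: "linear_map S (*) (\<phi> g)" and \<psi>_linear: "linear_map S (*) (\<psi> g)"
  using \<phi>_H1[of g] group.inv_closed[OF group_H1 \<phi>_H1, of g] by (auto simp: H1_iff)

lemmas [multilinear] = linear_map_compose[OF _ \<phi>_linear] linear_map_compose[OF _ \<psi>_linear]

lemma \<phi>_\<psi>:
  "sweedler A (*) b (\<lambda>x y. \<phi> g x * \<psi> g y) = counit A b"
  "sweedler A (*) b (\<lambda>x y. \<psi> g x * \<phi> g y) = counit A b"
  using group.r_inv[OF group_H1 \<phi>_H1, of g] group.l_inv[OF group_H1 \<phi>_H1, of g]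
  by (auto simp: H1_def conv_def dest: fun_cong)

lemma linear_extension_homog:
  "a \<in> homog g \<Longrightarrow> linear_extension f (p a) b = counit A a * f g b"
  by (simp add: p_homog linear_extension_def lincomb_def)

lemma linear_map_linear_extension [multilinear]:
  "linear_map r S f \<Longrightarrow> linear_map r (*) (\<lambda>x. linear_extension f' (p (f x)) b)"
  unfolding linear_extension_def
  by (rule linear_map_compose[OF linear_map_p linear_lincomb[OF vector_space_mult]])

lemma linear_map_linear_extension_fun:
  assumes "vector_space r" "\<And>g. linear_map r (*) (\<lambda>x. f' g (f x))"
  shows "linear_map r (*) (\<lambda>x. linear_extension f' w (f x))"
  unfolding linear_extension_def lincomb_def by (intro multilinear assms)

lemma linear_map_\<sigma>\<tau> [multilinear]:
  assumes f: "linear_map r S f"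
  shows "linear_map r (*) (\<lambda>x. \<sigma> a (f x))" "linear_map r (*) (\<lambda>x. \<tau> a (f x))"
proof -
  have r: "vector_space r" using f by (simp add: linear_map_iff)
  show "linear_map r (*) (\<lambda>x. \<sigma> a (f x))" "linear_map r (*) (\<lambda>x. \<tau> a (f x))"
    by (intro linear_map_linear_extension_fun multilinear f r)+
qed

text \<open>For a of degree g both legs of a carry the index g, so in the legs of b the characters
  \<psi>_g and \<phi>_g cancel; the counits left over from a combine by the counit law.\<close>

lemma conv2_inverse_\<sigma>: "conv2_inverse A \<sigma> \<tau>"
  unfolding conv2_inverse_def
proof (intro conjI ext)
  show "bilinear_form A \<sigma>" "bilinear_form A \<tau>"
    unfolding bilinear_form_def by (intro bilinear_mapI multilinear)+
  show "conv2 A \<sigma> \<tau> a b = counit A a * counit A b" for a b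
  proof (rule linear_map_eq_on_homog[of "(*)" _ _ a])
    fix g a assume a: "a \<in> homog g"
    have "conv2 A \<sigma> \<tau> a b = sweedler A (*) a (\<lambda>x y. counit A x * (counit A y * counit A b))"
      unfolding conv2_def
    proof (rule sweedler_homog_cong[OF a]; (intro multilinear)?)
      fix x y assume "x \<in> homog g" "y \<in> homog g"
      then have "sweedler A (*) b (\<lambda>u v. \<sigma> x u * \<tau> y v) =
          sweedler A (*) b (\<lambda>u v. counit A x * counit A y * (\<psi> g u * \<phi> g v))"
        by (simp add: linear_extension_homog mult_ac)
      then show "sweedler A (*) b (\<lambda>u v. \<sigma> x u * \<tau> y v) = counit A x * (counit A y * counit A b)"
        unfolding sweedler_mult_left[symmetric] \<phi>_\<psi> by (simp add: mult.assoc)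
    qed
    also have "\<dots> = counit A a * counit A b"
      by (rule sweedler_counit_left) (intro multilinear)
    finally show "conv2 A \<sigma> \<tau> a b = counit A a * counit A b" .
  qed (unfold conv2_def, (intro multilinear)+)
  show "conv2 A \<tau> \<sigma> a b = counit A a * counit A b" for a b
  proof (rule linear_map_eq_on_homog[of "(*)" _ _ a])
    fix g a assume a: "a \<in> homog g"
    have "conv2 A \<tau> \<sigma> a b = sweedler A (*) a (\<lambda>x y. counit A x * (counit A y * counit A b))"
      unfolding conv2_def
    proof (rule sweedler_homog_cong[OF a]; (intro multilinear)?)
      fix x y assume "x \<in> homog g" "y \<in> homog g"
      then have "sweedler A (*) b (\<lambda>u v. \<tau> x u * \<sigma> y v) =
          sweedler A (*) b (\<lambda>u v. counit A x * counit A y * (\<phi> g u * \<psi> g v))"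
        by (simp add: linear_extension_homog mult_ac)
      then show "sweedler A (*) b (\<lambda>u v. \<tau> x u * \<sigma> y v) = counit A x * (counit A y * counit A b)"
        unfolding sweedler_mult_left[symmetric] \<phi>_\<psi> by (simp add: mult.assoc)
    qed
    also have "\<dots> = counit A a * counit A b"
      by (rule sweedler_counit_left) (intro multilinear)
    finally show "conv2 A \<tau> \<sigma> a b = counit A a * counit A b" .
  qed (unfold conv2_def, (intro multilinear)+)
qed

lemma twisted_mult_\<sigma>: "twisted_mult A \<sigma> = tmult"
proof (intro ext)
  fix a b
  let ?T = "\<lambda>x y z. sweedler3 A S b (\<lambda>u v w. S (\<sigma> x u * \<tau> z w) (hmult A y v))"
  have tw: "twisted_mult A \<sigma> a b = sweedler A S a (\<lambda>x z. sweedler A S x (\<lambda>x y. ?T x y z))" for a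
    unfolding twisted_mult_def the_conv2_inverse[OF conv2_inverse_\<sigma>] by (simp only: sweedler3_def)
  show "twisted_mult A \<sigma> a b = tmult a b"
  proof (rule linear_map_eq_on_homog[of S _ _ a])
    fix g a assume a: "a \<in> homog g"
    \<comment> \<open>Only the outer legs x and z meet \<sigma> and \<tau>, so only they need a
      degree.\<close>
    have T: "?T x y z = S (counit A z) (S (counit A x) (hmult A y (\<alpha> g b)))"
      if "x \<in> homog g" "z \<in> homog g" for x y z
    proof -
      have "?T x y z = sweedler3 A S b (\<lambda>u v w. S (counit A z * counit A x) (hmult A y (S (\<psi> g u * \<phi> g w) v)))"
        using that by (simp add: linear_extension_homog mult_ac)
      \<comment> \<open>With the scalars and y taken out, the sum over b is exactly the conjugation
        formula for \<alpha>_g(b).\<close>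
      also have "\<dots> = S (counit A z * counit A x) (hmult A y (\<alpha> g b))"
        unfolding action_conjugation sweedler3_def sweedler_scale_left sweedler_hmult_left ..
      finally show ?thesis by simp
    qed
    have "twisted_mult A \<sigma> a b = sweedler A S a (\<lambda>x z. S (counit A z) (hmult A x (\<alpha> g b)))"
      unfolding tw
    proof (rule sweedler_homog_cong[OF a])
      fix x z assume x: "x \<in> homog g" and z: "z \<in> homog g"
      \<comment> \<open>The threefold coproduct is nested: the outer one gave x and z degree g, and
        now the legs of x get degree g in turn. Each level removes one counit.\<close>
      have "sweedler A S x (\<lambda>x y. ?T x y z) =
          sweedler A S x (\<lambda>x y. S (counit A z) (S (counit A x) (hmult A y (\<alpha> g b))))"
        by (rule sweedler_homog_cong[OF x]; ((unfold sweedler3_def)?, intro multilinear)?)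
          (simp add: T z)
      also have "\<dots> = S (counit A z) (hmult A x (\<alpha> g b))"
        unfolding sweedler_scale_left[symmetric]
        by (rule arg_cong[where f = "S c" for c], rule sweedler_counit_left) (intro multilinear)
      finally show "sweedler A S x (\<lambda>x y. ?T x y z) = S (counit A z) (hmult A x (\<alpha> g b))" .
    qed (unfold sweedler3_def, (intro multilinear)+)
    also have "\<dots> = hmult A a (\<alpha> g b)"
      by (rule sweedler_counit_right) (intro multilinear)
    also have "\<dots> = tmult a b" by (simp add: tmult_homog[OF a])
    finally show "twisted_mult A \<sigma> a b = tmult a b" .
  qed (unfold tw sweedler3_def, (intro multilinear)+)
qed

lemma twist_\<sigma>: "twist A \<sigma> = At"
  unfolding twist_def twisted_mult_\<sigma> by (simp add: the_antipode[OF hopf_algebra_twist])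

lemma pseudo_2_cocycle_\<sigma>: "pseudo_2_cocycle A \<sigma>"
  unfolding pseudo_2_cocycle_def twisted_mult_\<sigma>
  using conv2_inverse_\<sigma> hopf_algebra_twist by blast

end

theorem theorem2p8:
  fixes A :: "('k::field, 'a::ab_group_add) hopf"
    and p :: "'a \<Rightarrow> ('g::group_add \<Rightarrow>\<^sub>0 'k)"
    and \<alpha> :: "'g \<Rightarrow> 'a \<Rightarrow> 'a"
    and \<phi> :: "'g \<Rightarrow> 'a \<Rightarrow> 'k"
    and \<mu> :: "'g \<Rightarrow> 'g \<Rightarrow> 'a \<Rightarrow> 'k"
    and \<sigma> :: "'a \<Rightarrow> 'a \<Rightarrow> 'k"
    and j :: "'a \<Rightarrow> ('g \<Rightarrow>\<^sub>0 'a)"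
  assumes "hopf_algebra A"
    and "invariant_cocentral_action A p \<alpha>"
    and "almost_adjoint A \<alpha> \<phi> \<mu>"
    and "\<And>a b. \<sigma> a b = linear_extension (\<lambda>g. inv\<^bsub>H1 A\<^esub> (\<phi> g)) (p a) b"
    and "\<And>a. j a = sweedler A (pm_scale (hscale A)) a (\<lambda>x y. gtensor A x (p y))"
  shows "(pseudo_2_cocycle A \<sigma> \<and> conv2_inverse A \<sigma> (\<lambda>a b. linear_extension \<phi> (p a) b)) \<and>
    hopf_iso_onto (twist A \<sigma>) (crossed_product A \<alpha>) (graded_twisting A p \<alpha>) j"
proof -
  interpret hopf_algebra A by fact
  interpret T: almost_adjoint_action A \<alpha> p \<phi>
    using assms(2,3) unfolding invariant_cocentral_action_def almost_adjoint_def
    by unfold_locales auto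
  have \<sigma>: "\<sigma> = (\<lambda>a b. linear_extension (\<lambda>g. inv\<^bsub>H1 A\<^esub> (\<phi> g)) (p a) b)"
    and j: "j = T.grade"
    using assms(4,5) by (auto simp: T.grade_def)
  show ?thesis
    unfolding \<sigma> j T.twist_\<sigma>
    by (intro conjI T.pseudo_2_cocycle_\<sigma> T.conv2_inverse_\<sigma> T.hopf_iso_onto_grade)
qed

end
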